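(* Let $p$ be a prime such that $p\equiv\pm1\pmod{12}$. Then $$P_{[p/4]}\left(\frac{7}{12}\sqrt3\right)\equiv\begin{cases}\left(\dfrac{2+2\sqrt3}{p}\right)2x\pmod p&\text{if } p=x^2+9y^2\equiv1\pmod{12}\text{ with } x,y\in\mathbb{Z},\ 3\mid x-1,\\[2mm] 0\pmod p&\text{if } p\equiv 11\pmod{12}\end{cases}$$ and $$\sum_{k=0}^{p-1}\frac{\binom{2k}{k}^2\binom{4k}{2k}}{(-12288)^k}\equiv\begin{cases}4x^2\pmod p&\text{if } p=x^2+9y^2\equiv1\pmod{12}\text{ with } x,y\in\mathbb{Z},\\ 0\pmod{p^2}&\text{if } p\equiv11\pmod{12}.\end{cases}$$
   Context: $[a]$ is the greatest integer not exceeding $a$. $P_n(x)$ is the Legendre polynomial $P_n(x)=\frac{1}{2^n}\sum_{k=0}^{[n/2]}\binom{n}{k}(-1)^k\binom{2n-2k}{n}x^{n-2k}$. $\left(\frac{a}{p}\right)$ is the Legendre symbol. Congruences between rational numbers modulo $p$ or $p^2$ are taken in the ring of rationals whose denominators are coprime to $p$. In the first congruence, $\sqrt3$ denotes a fixed element $s\in\mathbb{F}_p$ with $s^2=3$ (either choice, the same throughout; it exists because $p\equiv\pm1\pmod{12}$), and the congruence modulo $p$ is equality in $\mathbb{F}_p$. *)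

theory Defs
  imports
    "HOL-Number_Theory.Number_Theory"
    "HOL-Computational_Algebra.Computational_Algebra"
begin

definition legendre_poly :: "nat \<Rightarrow> 'a::field_char_0 poly" where
  "legendre_poly n =
     smult (1 / 2 ^ n)
       (\<Sum>k\<le>n div 2.
          monom (of_nat (n choose k) * (- 1) ^ k * of_nat ((2 * n - 2 * k) choose n)) (n - 2 * k))"

definition p_integral :: "nat \<Rightarrow> rat set" where
  "p_integral p = {r. coprime (snd (quotient_of r)) (int p)}"

text \<open>
  Congruence modulo \<open>m\<close> in the ring \<open>p_integral p\<close> (the intended moduli are \<open>p\<close> and \<open>p\<^sup>2\<close>);
  both sides are required to lie in this ring. For \<open>m = p\<close> it says that the images of \<open>a\<close> and
  \<open>b\<close> in the field with \<open>p\<close> elements are equal.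
\<close>
definition rat_cong :: "nat \<Rightarrow> nat \<Rightarrow> rat \<Rightarrow> rat \<Rightarrow> bool" where
  "rat_cong p m a b \<longleftrightarrow>
     a \<in> p_integral p \<and> b \<in> p_integral p \<and> (\<exists>t\<in>p_integral p. a - b = of_nat m * t)"

end

theory Submission
  imports Defs
begin

text \<open>
  Write \<open>c\<^sub>k = binomial (2 k) k * binomial (4 k) (2 k)\<close>, let \<open>s\<close> be a square root of 3 modulo \<open>p\<close>, and put
  \<open>t = 7 s / 12\<close>, \<open>v = (1 - t) / 128\<close> and \<open>C = (\<Sum>k<p. c\<^sub>k v\<^sup>k)\<close>. Expanding the Legendre polynomial at 1
  gives \<open>P\<^sub>n(t) = C\<close> modulo \<open>p\<close> for \<open>n = p div 4\<close> (\<open>legendre_poly_rat_cong\<close>). On the other hand \<open>- C\<close> is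
  modulo \<open>p\<close> the sum of Legendre symbols of the cubic \<open>x\<^sup>3 + x\<^sup>2 + 16 v x\<close> (\<open>quartic_curve_sum\<close>), so the
  first congruence is a statement about the Frobenius trace of an elliptic curve. This curve
  is the reduction of one with complex multiplication by \<open>\<int>[3 i]\<close>; it is 3-isogenous, up to a
  quadratic twist, to \<open>y\<^sup>2 = x\<^sup>3 - k x\<close> with \<open>k = 2 s - 3\<close>.

  The isogeny is used in the following elementary form. A curve with a subgroup of order
  three can be written as \<open>y\<^sup>2 = x\<^sup>3 + d (x + 4 d r)\<^sup>2\<close>, and modulo \<open>p\<close> its Legendre symbol sum is, up to sign,
  \<open>d\<close> to the power \<open>(p - 1) / 2\<close> times the value of the Legendre polynomial of degree \<open>p div 3\<close> at
  \<open>1 - 54 r\<close> (\<open>cubic_curve_sum\<close>). Passing to the isogenous curve replaces \<open>27 r\<close> by \<open>1 - 27 r\<close>, so the two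
  sums are compared by the parity of Legendre polynomials (\<open>isogenous_models\<close>).

  For \<open>p\<close> congruent to 11 modulo 12 the sum for \<open>x\<^sup>3 - k x\<close> vanishes because the cubic is odd and \<open>- 1\<close> is
  not a square. For \<open>p\<close> congruent to 1 it is a Jacobsthal sum \<open>J\<close>. Jacobsthal's identity
  \<open>J\<^sup>2 + K\<^sup>2 = 4 p\<close> gives \<open>J = \<plusminus> 2 x\<close> once it is known that 3 does not divide \<open>J\<close>, and the sign
  is found from \<open>J = 1\<close> modulo 3. The latter holds since the points with \<open>x \<noteq> 0\<close> on
  \<open>y\<^sup>2 = x\<^sup>3 + (a x + b)\<^sup>2\<close> correspond to triples with \<open>P + Q + R = 2 a\<close> and \<open>P Q R = 2 b\<close>, which a cyclic
  rotation permutes without fixed points (\<open>cubic_sum_mod_3\<close>).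

  The second congruence is reduced to the first by a truncated form of Clausen's identity: modulo
  \<open>p\<^sup>2\<close>, the square of \<open>C\<close> equals \<open>(\<Sum>k<p. binomial (2 k) k * c\<^sub>k w\<^sup>k)\<close> for \<open>w = v (1 - 64 v)\<close>
  (\<open>clausen_truncated\<close>). If \<open>s\<close> is a square root of 3 modulo \<open>p\<^sup>2\<close>, then \<open>w = - 1 / 12288\<close> modulo \<open>p\<^sup>2\<close>.
\<close>

section \<open>Sums over the residues modulo an odd prime\<close>

locale odd_prime =
  fixes p :: nat
  assumes prime_p: "prime p" and p_gt_2: "p > 2"
begin

text \<open>The field with \<open>p\<close> elements is represented by the integers \<open>0, \<dots>, p - 1\<close>; functions on it
are functions on the integers that only depend on the argument modulo \<open>p\<close>.\<close>

definition residues_mod :: "int set" where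
  "residues_mod = {0..<int p}"

lemma finite_residues [simp]: "finite residues_mod"
  by (simp add: residues_mod_def)

lemma card_residues [simp]: "card residues_mod = p"
  by (simp add: residues_mod_def)

lemma odd_p: "odd p"
  using prime_p p_gt_2 prime_odd_nat by blast

lemma prime_int: "prime (int p)"
  using prime_p by simp

lemma mod_in_residues [simp]: "x mod int p \<in> residues_mod"
  using p_gt_2 by (simp add: residues_mod_def)

lemma residues_cong_iff:
  "x \<in> residues_mod \<Longrightarrow> y \<in> residues_mod \<Longrightarrow> [x = y] (mod int p) \<longleftrightarrow> x = y"
  by (auto simp: residues_mod_def cong_def)

lemma mult_cancel_cong:
  "\<not> int p dvd a \<Longrightarrow> [a * x = a * y] (mod int p) \<longleftrightarrow> [x = y] (mod int p)"
  using prime_int prime_imp_coprime[of "int p" a]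
  by (intro cong_mult_lcancel) (simp add: coprime_commute)

lemma inverse_mod_exists:
  assumes "\<not> int p dvd a"
  obtains b where "[a * b = 1] (mod int p)"
proof -
  have "coprime a (int p)"
    using prime_imp_coprime[OF prime_int assms] by (simp add: coprime_commute)
  then show ?thesis using cong_solve_coprime_int that by blast
qed

lemma sum_residues_reindex:
  fixes f :: "int \<Rightarrow> 'b::comm_monoid_add"
  assumes per: "\<And>x. f (x mod int p) = f x"
    and inj: "\<And>x y. [g x = g y] (mod int p) \<Longrightarrow> [x = y] (mod int p)"
  shows "(\<Sum>x\<in>residues_mod. f (g x)) = (\<Sum>x\<in>residues_mod. f x)"
proof -
  let ?h = "\<lambda>x. g x mod int p"
  have "inj_on ?h residues_mod"
  proof (rule inj_onI)
    fix x y assume xy: "x \<in> residues_mod" "y \<in> residues_mod" "?h x = ?h y"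
    then have "[g x = g y] (mod int p)" by (simp add: cong_def)
    from inj[OF this] xy show "x = y" by (simp add: residues_cong_iff)
  qed
  moreover have "?h ` residues_mod \<subseteq> residues_mod" by auto
  ultimately have "bij_betw ?h residues_mod residues_mod"
    by (simp add: bij_betw_def endo_inj_surj)
  then have "(\<Sum>x\<in>residues_mod. f (?h x)) = (\<Sum>x\<in>residues_mod. f x)"
    by (rule sum.reindex_bij_betw)
  then show ?thesis by (simp add: per)
qed

lemma sum_residues_shift:
  fixes f :: "int \<Rightarrow> 'b::comm_monoid_add"
  assumes "\<And>x. f (x mod int p) = f x"
  shows "(\<Sum>x\<in>residues_mod. f (x + c)) = (\<Sum>x\<in>residues_mod. f x)"
  by (rule sum_residues_reindex[where f = f]) (simp_all add: assms cong_add_rcancel)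

lemma sum_residues_scale:
  fixes f :: "int \<Rightarrow> 'b::comm_monoid_add"
  assumes "\<And>x. f (x mod int p) = f x" and "\<not> int p dvd a"
  shows "(\<Sum>x\<in>residues_mod. f (a * x)) = (\<Sum>x\<in>residues_mod. f x)"
  by (rule sum_residues_reindex[where f = f]) (simp_all add: assms(1) mult_cancel_cong[OF assms(2)])

lemma cong_sum_residues_reindex:
  fixes f :: "int \<Rightarrow> int"
  assumes per: "\<And>x. [f (x mod int p) = f x] (mod int p)"
    and inj: "\<And>x y. [g x = g y] (mod int p) \<Longrightarrow> [x = y] (mod int p)"
  shows "[(\<Sum>x\<in>residues_mod. f (g x)) = (\<Sum>x\<in>residues_mod. f x)] (mod int p)"
proof -
  have "(\<Sum>x\<in>residues_mod. f (g x) mod int p) = (\<Sum>x\<in>residues_mod. f x mod int p)"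
    by (rule sum_residues_reindex[where f = "\<lambda>x. f x mod int p"])
      (rule per[unfolded cong_def], rule inj)
  then show ?thesis
    using mod_sum_eq[of "\<lambda>x. f (g x)" "int p" residues_mod] mod_sum_eq[of f "int p" residues_mod]
    by (simp add: cong_def)
qed

lemma sum_power_cong_0:
  assumes "\<not> (p - 1) dvd j"
  shows "[(\<Sum>x\<in>residues_mod. x ^ j) = 0] (mod int p)"
proof -
  obtain g where g: "residue_primroot p g"
    using prime_primitive_root_exists[of p] prime_p p_gt_2 by auto
  have cop: "coprime p g" and ord: "ord p g = p - 1"
    using g prime_p by (simp_all add: residue_primroot_def totient_prime)
  have nd: "\<not> int p dvd int g"
  proof
    assume "int p dvd int g"
    then have "p dvd g" by simp
    with cop have "is_unit p" by (metis coprime_absorb_left)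
    with prime_p show False by (metis not_prime_unit)
  qed
  have ne: "\<not> [g ^ j = 1] (mod p)"
    using assms ord by (metis ord_divides)
  let ?S = "\<Sum>x\<in>residues_mod. x ^ j"
  have "[(\<Sum>x\<in>residues_mod. (int g * x) ^ j) = ?S] (mod int p)"
    by (rule cong_sum_residues_reindex[where f = "\<lambda>x. x ^ j"])
      (use nd in \<open>simp_all add: cong_def power_mod mult_cancel_cong[unfolded cong_def]\<close>)
  then have "[int g ^ j * ?S = ?S] (mod int p)"
    by (simp add: power_mult_distrib sum_distrib_left)
  then have "int p dvd (int g ^ j - 1) * ?S"
    by (simp add: cong_iff_dvd_diff algebra_simps)
  moreover have "\<not> int p dvd (int g ^ j - 1)"
    using ne by (metis cong_iff_dvd_diff cong_int_iff of_nat_1 of_nat_power)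
  ultimately show ?thesis
    using prime_int by (simp add: prime_dvd_mult_iff cong_0_iff)
qed

lemma fermat_cong: "\<not> int p dvd x \<Longrightarrow> [x ^ (p - 1) = 1] (mod int p)"
proof -
  assume x: "\<not> int p dvd x"
  have eq: "int (nat (x mod int p)) = x mod int p"
    using p_gt_2 by simp
  have "\<not> p dvd nat (x mod int p)"
    using x eq by (metis dvd_mod_iff dvd_refl int_dvd_int_iff)
  then have "[nat (x mod int p) ^ (p - 1) = 1] (mod p)"
    using prime_p by (rule fermat_theorem[rotated])
  then have "[(x mod int p) ^ (p - 1) = 1] (mod int p)"
    using eq by (metis cong_int_iff of_nat_1 of_nat_power)
  then show ?thesis
    by (simp add: cong_def power_mod)
qed

lemma sum_power_fermat: "[(\<Sum>x\<in>residues_mod. x ^ (p - 1)) = - 1] (mod int p)"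
proof -
  have R: "residues_mod = insert 0 {1..<int p}"
    using p_gt_2 by (auto simp: residues_mod_def)
  have "[(\<Sum>x\<in>{1..<int p}. x ^ (p - 1)) = (\<Sum>x\<in>{1..<int p}. 1)] (mod int p)"
    by (intro cong_sum fermat_cong) (auto dest: zdvd_imp_le)
  moreover have "(\<Sum>x\<in>{1..<int p}. 1) = int p - 1"
    using p_gt_2 by simp
  moreover have "(\<Sum>x\<in>residues_mod. x ^ (p - 1)) = (\<Sum>x\<in>{1..<int p}. x ^ (p - 1))"
    using p_gt_2 by (simp add: R power_0_left)
  ultimately show ?thesis
    by (simp add: cong_def)
qed

text \<open>Sums of powers with exponent not divisible by \<open>p - 1\<close> vanish modulo \<open>p\<close>, as does the sum of the
constant \<open>1\<close>, so below degree \<open>2 * (p - 1)\<close> only the coefficient with index \<open>p - 1\<close> survives.\<close>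

lemma sum_poly_mod:
  fixes F :: "int poly"
  assumes "degree F < 2 * (p - 1)"
  shows "[(\<Sum>x\<in>residues_mod. poly F x) = - coeff F (p - 1)] (mod int p)"
proof -
  have "(\<Sum>x\<in>residues_mod. poly F x) = (\<Sum>i\<le>degree F. coeff F i * (\<Sum>x\<in>residues_mod. x ^ i))"
    by (simp add: poly_altdef sum_distrib_left) (rule sum.swap)
  also have "[\<dots> = (\<Sum>i\<le>degree F. if i = p - 1 then - coeff F i else 0)] (mod int p)"
  proof (rule cong_sum)
    fix i assume i: "i \<in> {..degree F}"
    consider "i = 0" | "i = p - 1" | "\<not> (p - 1) dvd i"
    proof -
      have "i = 0 \<or> i = p - 1" if "(p - 1) dvd i"
      proof -
        from that obtain k where k: "i = (p - 1) * k" by (rule dvdE)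
        with i assms have "(p - 1) * k < (p - 1) * 2" by (metis atMost_iff le_less_trans mult.commute)
        then have "k < 2" by (rule mult_left_less_imp_less) simp
        then have "k = 0 \<or> k = 1" by auto
        with k show ?thesis by auto
      qed
      then show ?thesis using that by blast
    qed
    then show "[coeff F i * (\<Sum>x\<in>residues_mod. x ^ i) = (if i = p - 1 then - coeff F i else 0)] (mod int p)"
    proof cases
      case 1 then show ?thesis using p_gt_2 by (simp add: cong_0_iff)
    next
      case 2 then show ?thesis
        using cong_scalar_left[OF sum_power_fermat, of "coeff F i"] by simp
    next
      case 3
      then have "i \<noteq> p - 1" by auto
      then show ?thesis
        using cong_scalar_left[OF sum_power_cong_0[OF 3], of "coeff F i"] by simp
    qed
  qed
  also have "(\<Sum>i\<le>degree F. if i = p - 1 then - coeff F i else 0) = - coeff F (p - 1)"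
    by (simp add: coeff_eq_0)
  finally show ?thesis .
qed

end

section \<open>Legendre symbols of cubic polynomials\<close>

lemma three_dvd_card_of_order_3:
  assumes "finite W" "\<And>x. x \<in> W \<Longrightarrow> t x \<in> W" "\<And>x. x \<in> W \<Longrightarrow> t (t (t x)) = x"
    and "\<And>x. x \<in> W \<Longrightarrow> t x \<noteq> x"
  shows "3 dvd card W"
  using assms
proof (induction "card W" arbitrary: W rule: less_induct)
  case less
  show ?case
  proof (cases "W = {}")
    case False
    then obtain x where x: "x \<in> W" by auto
    let ?O = "{x, t x, t (t x)}"
    have sub: "?O \<subseteq> W" using x less.prems(2) by auto
    have "t (t x) \<noteq> x" using x less.prems(3,4) by metis
    moreover have "t x \<noteq> x" "t (t x) \<noteq> t x" using x less.prems(2,4) by auto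
    ultimately have c3: "card ?O = 3" by auto
    have "t y \<in> W - ?O" if y: "y \<in> W - ?O" for y
    proof -
      have "t y \<in> W" using y less.prems(2) by auto
      moreover have "t y \<notin> ?O"
      proof
        assume "t y \<in> ?O"
        then have "t (t (t y)) \<in> ?O" using less.prems(3)[OF x] by auto
        then show False using less.prems(3)[of y] y by auto
      qed
      ultimately show ?thesis by auto
    qed
    moreover have cW: "card W = card (W - ?O) + 3"
      using card_Diff_subset[OF _ sub] card_mono[OF less.prems(1) sub] c3 by auto
    ultimately have "3 dvd card (W - ?O)"
      using less.prems by (intro less.hyps) auto
    then show ?thesis using cW by auto
  qed auto
qed

text \<open>The classical argument for norms: \<open>p\<close> divides \<open>x * Y - X * y\<close> or \<open>x * Y + X * y\<close>, and the identity
of Brahmagupta for \<open>p\<^sup>2\<close> leaves no room for a nonzero multiple of \<open>p\<close>.\<close>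

lemma prime_sum_square_9_unique:
  fixes x y X Y :: int
  assumes "prime p" and xy: "int p = x\<^sup>2 + 9 * y\<^sup>2" and XY: "int p = X\<^sup>2 + 9 * Y\<^sup>2"
  shows "x\<^sup>2 = X\<^sup>2"
proof -
  define P where "P = int p"
  have pP: "prime P" using assms(1) by (simp add: P_def)
  then have pos: "P > 0" by (simp add: prime_gt_0_int)
  have xy: "x\<^sup>2 = P - 9 * y\<^sup>2" and XY: "X\<^sup>2 = P - 9 * Y\<^sup>2" using xy XY by (auto simp: P_def)
  have "(x * Y - X * y) * (x * Y + X * y) = x\<^sup>2 * Y\<^sup>2 - X\<^sup>2 * y\<^sup>2"
    by (simp add: algebra_simps power2_eq_square)
  also have e: "\<dots> = P * (Y\<^sup>2 - y\<^sup>2)"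
    unfolding xy XY by (simp add: algebra_simps)
  finally have prod: "(x * Y - X * y) * (x * Y + X * y) = P * (Y\<^sup>2 - y\<^sup>2)" .
  have small: "z = 0" if "P dvd z" "P\<^sup>2 = w\<^sup>2 + 9 * z\<^sup>2" for w z
  proof (rule ccontr)
    assume "z \<noteq> 0"
    with that(1) have "P \<le> \<bar>z\<bar>" by (metis dvd_abs_iff zdvd_imp_le zero_less_abs_iff)
    then have "P\<^sup>2 \<le> z\<^sup>2" using pos by (simp add: abs_le_square_iff[symmetric])
    moreover have "w\<^sup>2 \<ge> 0" "P\<^sup>2 > 0" using pos by auto
    ultimately show False using that(2) by linarith
  qed
  have i1: "P\<^sup>2 = (x * X + 9 * y * Y)\<^sup>2 + 9 * (x * Y - X * y)\<^sup>2"
  proof -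
    have "(x * X + 9 * y * Y)\<^sup>2 + 9 * (x * Y - X * y)\<^sup>2 = (x\<^sup>2 + 9 * y\<^sup>2) * (X\<^sup>2 + 9 * Y\<^sup>2)"
      by (simp add: algebra_simps power2_eq_square)
    then show ?thesis unfolding xy XY by (simp add: power2_eq_square)
  qed
  have i2: "P\<^sup>2 = (x * X - 9 * y * Y)\<^sup>2 + 9 * (x * Y + X * y)\<^sup>2"
  proof -
    have "(x * X - 9 * y * Y)\<^sup>2 + 9 * (x * Y + X * y)\<^sup>2 = (x\<^sup>2 + 9 * y\<^sup>2) * (X\<^sup>2 + 9 * Y\<^sup>2)"
      by (simp add: algebra_simps power2_eq_square)
    then show ?thesis unfolding xy XY by (simp add: power2_eq_square)
  qed
  have "P dvd (x * Y - X * y) * (x * Y + X * y)" unfolding prod by simp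
  then have "P dvd x * Y - X * y \<or> P dvd x * Y + X * y"
    using pP by (simp add: prime_dvd_mult_iff)
  then have "(x * Y - X * y) * (x * Y + X * y) = 0"
    using small[OF _ i1] small[OF _ i2] by auto
  then have "Y\<^sup>2 = y\<^sup>2" using prod pos by simp
  then show ?thesis using xy XY by simp
qed

context odd_prime
begin

abbreviation chi :: "int \<Rightarrow> int" where
  "chi a \<equiv> Legendre a (int p)"

lemma chi_cases: "chi a = 0 \<or> chi a = 1 \<or> chi a = - 1"
  by (auto simp: Legendre_def)

lemma chi_cong: "[a = b] (mod int p) \<Longrightarrow> chi a = chi b"
  unfolding Legendre_def QuadRes_def by (simp add: cong_def)

lemma chi_eq_0_iff: "chi a = 0 \<longleftrightarrow> int p dvd a"
  by (auto simp: Legendre_def cong_0_iff)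

lemma chi_0 [simp]: "chi 0 = 0"
  by (simp add: chi_eq_0_iff)

lemma chi_euler: "[chi a = a ^ ((p - 1) div 2)] (mod int p)"
  using euler_criterion[OF prime_p p_gt_2] .

lemma small_cong_eq:
  assumes "[a = b] (mod int p)" "\<bar>a - b\<bar> < int p"
  shows "a = b"
  using assms by (metis cong_iff_dvd_diff dvd_imp_le_int eq_iff_diff_eq_0 abs_of_nat linorder_not_le)

lemma chi_eqI:
  assumes "[chi a = b] (mod int p)" "b = 0 \<or> b = 1 \<or> b = -1"
  shows "chi a = b"
  by (rule small_cong_eq[OF assms(1)]) (use assms(2) chi_cases[of a] p_gt_2 in auto)

lemma chi_mult: "chi (a * b) = chi a * chi b"
proof (rule chi_eqI)
  have "[chi (a * b) = (a * b) ^ ((p - 1) div 2)] (mod int p)" by (rule chi_euler)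
  also have "(a * b) ^ ((p - 1) div 2) = a ^ ((p - 1) div 2) * b ^ ((p - 1) div 2)"
    by (simp add: power_mult_distrib)
  also have "[\<dots> = chi a * chi b] (mod int p)"
    by (intro cong_mult) (rule chi_euler[THEN cong_sym])+
  finally show "[chi (a * b) = chi a * chi b] (mod int p)" .
qed (use chi_cases[of a] chi_cases[of b] in auto)

lemma chi_square: "\<not> int p dvd a \<Longrightarrow> chi (a\<^sup>2) = 1"
  using chi_cases[of a] chi_eq_0_iff[of a] by (auto simp: power2_eq_square chi_mult)

lemma chi_1 [simp]: "chi 1 = 1"
  using chi_square[of 1] p_gt_2 by simp

lemma chi_cube: "chi (a ^ 3) = chi a"
  using chi_cases[of a] by (auto simp: power3_eq_cube chi_mult)

lemma sum_chi: "(\<Sum>x\<in>residues_mod. chi x) = 0"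
proof (rule small_cong_eq)
  have "[(\<Sum>x\<in>residues_mod. chi x) = (\<Sum>x\<in>residues_mod. x ^ ((p - 1) div 2))] (mod int p)"
    by (intro cong_sum chi_euler)
  also have "[(\<Sum>x\<in>residues_mod. x ^ ((p - 1) div 2)) = 0] (mod int p)"
  proof (rule sum_power_cong_0)
    have "0 < (p - 1) div 2" "(p - 1) div 2 < p - 1" using p_gt_2 by auto
    then show "\<not> p - 1 dvd (p - 1) div 2" using dvd_imp_le by (metis not_le)
  qed
  finally show "[(\<Sum>x\<in>residues_mod. chi x) = 0] (mod int p)" .
  have R: "residues_mod = insert 0 {1..<int p}"
    using p_gt_2 by (auto simp: residues_mod_def)
  have "\<bar>\<Sum>x\<in>residues_mod. chi x\<bar> = \<bar>\<Sum>x\<in>{1..<int p}. chi x\<bar>"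
    unfolding R by simp
  also have "\<dots> \<le> (\<Sum>x\<in>{1..<int p}. \<bar>chi x\<bar>)" by (rule sum_abs)
  also have "\<dots> \<le> (\<Sum>x\<in>{1..<int p}. 1)"
    by (intro sum_mono) (smt (verit) chi_cases)
  also have "\<dots> < int p" using p_gt_2 by simp
  finally show "\<bar>(\<Sum>x\<in>residues_mod. chi x) - 0\<bar> < int p" by simp
qed

lemma nonresidue_exists: obtains g where "chi g = - 1"
proof -
  have "\<exists>g. chi g = - 1"
  proof (rule ccontr)
    assume "\<nexists>g. chi g = - 1"
    then have nn: "chi x \<ge> 0" for x using chi_cases[of x] by auto
    have "1 \<in> residues_mod" using p_gt_2 by (simp add: residues_mod_def)
    then have "chi 1 \<le> (\<Sum>x\<in>residues_mod. chi x)"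
      by (intro member_le_sum) (auto simp: nn)
    then show False using sum_chi by simp
  qed
  then show ?thesis using that by blast
qed

text \<open>By Euler's criterion the sum is congruent to \<open>- 1\<close> when \<open>a\<close> and \<open>b\<close> differ, and it is too small in
absolute value to be \<open>p - 1\<close> because two of its terms vanish.\<close>

lemma sum_chi_quadratic:
  "(\<Sum>k\<in>residues_mod. chi ((k - a) * (k - b))) = (if [a = b] (mod int p) then int p - 1 else - 1)"
proof -
  define c where "c = a - b"
  have "(\<Sum>k\<in>residues_mod. chi ((k - a) * (k - b))) =
      (\<Sum>k\<in>residues_mod. chi (((k + a) - a) * ((k + a) - b)))"
    by (rule sum_residues_shift[where f = "\<lambda>k. chi ((k - a) * (k - b))", symmetric])
      (intro chi_cong cong_mult cong_diff, auto simp: cong_def)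
  also have "\<dots> = (\<Sum>k\<in>residues_mod. chi (k * (k + c)))"
    by (simp add: c_def algebra_simps)
  finally have eq: "(\<Sum>k\<in>residues_mod. chi ((k - a) * (k - b))) = (\<Sum>k\<in>residues_mod. chi (k * (k + c)))" .
  have R: "residues_mod = insert 0 {1..<int p}"
    using p_gt_2 by (auto simp: residues_mod_def)
  show ?thesis
  proof (cases "[a = b] (mod int p)")
    case True
    then have c: "int p dvd c" by (simp add: c_def cong_iff_dvd_diff)
    have "(\<Sum>k\<in>{1..<int p}. chi (k * (k + c))) = (\<Sum>k\<in>{1..<int p}. 1)"
    proof (rule sum.cong[OF refl])
      fix k assume k: "k \<in> {1..<int p}"
      then have "\<not> int p dvd k" by (auto dest: zdvd_imp_le)
      then have "chi (k\<^sup>2) = 1" by (rule chi_square)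
      moreover have "[k * (k + c) = k\<^sup>2] (mod int p)"
        using c by (simp add: cong_iff_dvd_diff power2_eq_square algebra_simps)
      ultimately show "chi (k * (k + c)) = 1" using chi_cong by metis
    qed
    then have "(\<Sum>k\<in>residues_mod. chi (k * (k + c))) = int p - 1"
      using p_gt_2 unfolding R by simp
    then show ?thesis using True unfolding eq by simp
  next
    case False
    then have c: "\<not> int p dvd c" by (simp add: c_def cong_iff_dvd_diff)
    let ?m = "(p - 1) div 2"
    have m2: "2 * ?m = p - 1" using odd_p by simp
    define F :: "int poly" where "F = [:0, c, 1:] ^ ?m"
    have deg: "degree F = p - 1"
      using m2 by (simp add: F_def degree_power_eq)
    have lc: "coeff F (p - 1) = 1"
    proof -
      have "lead_coeff F = 1" unfolding F_def lead_coeff_power by simp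
      then show ?thesis using deg by simp
    qed
    have "[(\<Sum>k\<in>residues_mod. chi (k * (k + c))) = (\<Sum>k\<in>residues_mod. poly F k)] (mod int p)"
    proof (rule cong_sum)
      fix k
      have "poly F k = (k * (k + c)) ^ ?m" by (simp add: F_def algebra_simps)
      then show "[chi (k * (k + c)) = poly F k] (mod int p)" using chi_euler by metis
    qed
    also have "[(\<Sum>k\<in>residues_mod. poly F k) = - coeff F (p - 1)] (mod int p)"
      by (rule sum_poly_mod) (use deg p_gt_2 in simp)
    finally have cg: "[(\<Sum>k\<in>residues_mod. chi (k * (k + c))) = - 1] (mod int p)" using lc by simp
    have "(\<Sum>k\<in>residues_mod. chi (k * (k + c))) = - 1"
    proof (rule small_cong_eq[OF cg])
      let ?B = "{1..<int p} - {(- c) mod int p}"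
      have mc: "(- c) mod int p \<in> {1..<int p}"
      proof -
        have "(- c) mod int p \<noteq> 0" using c by (metis dvd_minus_iff mod_0_imp_dvd)
        moreover have "(- c) mod int p \<ge> 0" "(- c) mod int p < int p" using p_gt_2 by auto
        ultimately show ?thesis by simp
      qed
      have z: "chi (((- c) mod int p) * ((- c) mod int p + c)) = 0"
      proof -
        have "[(- c) mod int p + c = - c + c] (mod int p)"
          by (intro cong_add) (auto simp: cong_def)
        then have "int p dvd (- c) mod int p + c" by (simp add: cong_0_iff)
        then show ?thesis by (simp add: chi_eq_0_iff)
      qed
      have "(\<Sum>k\<in>residues_mod. chi (k * (k + c))) = (\<Sum>k\<in>{1..<int p}. chi (k * (k + c)))"
        unfolding R by simp
      also have "\<dots> = (\<Sum>k\<in>?B. chi (k * (k + c)))"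
        using mc z by (simp add: sum.remove[OF _ mc])
      also have "\<bar>\<dots>\<bar> \<le> (\<Sum>k\<in>?B. \<bar>chi (k * (k + c))\<bar>)" by (rule sum_abs)
      also have "\<dots> \<le> (\<Sum>k\<in>?B. 1)"
        by (intro sum_mono) (smt (verit) chi_cases)
      also have "\<dots> = int p - 2" using mc p_gt_2 by (simp add: card_Diff_singleton)
      finally have "\<bar>\<Sum>k\<in>residues_mod. chi (k * (k + c))\<bar> \<le> int p - 2" .
      then show "\<bar>(\<Sum>k\<in>residues_mod. chi (k * (k + c))) - - 1\<bar> < int p" by linarith
    qed
    then show ?thesis using False unfolding eq by simp
  qed
qed

lemma card_square_roots: "int (card {y\<in>residues_mod. [y\<^sup>2 = a] (mod int p)}) = 1 + chi a"
proof -
  consider "int p dvd a" | "\<not> int p dvd a" "\<exists>y. [y\<^sup>2 = a] (mod int p)" | "\<not> (\<exists>y. [y\<^sup>2 = a] (mod int p))"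
    by blast
  then show ?thesis
  proof cases
    case 1
    have "[y\<^sup>2 = a] (mod int p) \<longleftrightarrow> y = 0" if "y \<in> residues_mod" for y
    proof -
      have "[y\<^sup>2 = a] (mod int p) \<longleftrightarrow> [y\<^sup>2 = 0] (mod int p)"
        using 1 by (metis cong_0_iff cong_sym cong_trans)
      also have "\<dots> \<longleftrightarrow> [y = 0] (mod int p)"
        using prime_int by (simp add: cong_0_iff prime_dvd_power_iff)
      also have "\<dots> \<longleftrightarrow> y = 0"
        using that p_gt_2 by (intro residues_cong_iff) (auto simp: residues_mod_def)
      finally show ?thesis .
    qed
    moreover have "0 \<in> residues_mod" using p_gt_2 by (simp add: residues_mod_def)
    ultimately have "{y\<in>residues_mod. [y\<^sup>2 = a] (mod int p)} = {0}" by blast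
    then show ?thesis using 1 by (simp add: chi_eq_0_iff[THEN iffD2])
  next
    case 2
    then obtain w where w: "[w\<^sup>2 = a] (mod int p)" by auto
    have nw: "\<not> int p dvd w"
      using 2(1) w by (metis cong_dvd_iff dvd_power zero_less_numeral dvd_trans)
    have "[y\<^sup>2 = a] (mod int p) \<longleftrightarrow> y = w mod int p \<or> y = (- w) mod int p" if "y \<in> residues_mod" for y
    proof -
      have "[y\<^sup>2 = a] (mod int p) \<longleftrightarrow> [y\<^sup>2 = w\<^sup>2] (mod int p)"
        using w by (metis cong_sym cong_trans)
      also have "\<dots> \<longleftrightarrow> int p dvd (y - w) * (y + w)"
        by (simp add: cong_iff_dvd_diff power2_eq_square algebra_simps)
      also have "\<dots> \<longleftrightarrow> [y = w] (mod int p) \<or> [y = - w] (mod int p)"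
        using prime_int by (simp add: prime_dvd_mult_iff cong_iff_dvd_diff)
      also have "\<dots> \<longleftrightarrow> y = w mod int p \<or> y = (- w) mod int p"
        using that by (simp add: cong_def residues_mod_def)
      finally show ?thesis .
    qed
    then have "{y\<in>residues_mod. [y\<^sup>2 = a] (mod int p)} = {w mod int p, (- w) mod int p}"
      by auto
    moreover have "w mod int p \<noteq> (- w) mod int p"
    proof
      assume "w mod int p = (- w) mod int p"
      then have "int p dvd 2 * w" by (simp add: mod_eq_dvd_iff)
      then have "int p dvd 2" using nw prime_int by (simp add: prime_dvd_mult_iff)
      then show False using p_gt_2 by (auto dest: zdvd_imp_le)
    qed
    moreover have "chi a = 1" using chi_square[OF nw] chi_cong[OF w] by simp
    ultimately show ?thesis by simp
  next
    case 3
    then have "{y\<in>residues_mod. [y\<^sup>2 = a] (mod int p)} = {}" by auto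
    moreover have "chi a = - 1"
    proof -
      have "\<not> [a = 0] (mod int p)"
        using 3 by (metis cong_sym zero_power2)
      then show ?thesis using 3 by (simp add: Legendre_def QuadRes_def)
    qed
    ultimately show ?thesis by simp
  qed
qed

lemma card_residues_eq_sum:
  "int (card {x\<in>residues_mod. Q x}) = (\<Sum>x\<in>residues_mod. if Q x then 1 else 0)"
  by (simp add: sum.If_cases Int_def)

lemma residues_eq_insert: "residues_mod = insert 0 {1..<int p}"
  using p_gt_2 by (auto simp: residues_mod_def)

lemma not_dvd_pos_residue: "x \<in> {1..<int p} \<Longrightarrow> \<not> int p dvd x"
  by (auto dest: zdvd_imp_le)

lemma not_dvd_2: "\<not> int p dvd 2"
  using p_gt_2 by (auto dest: zdvd_imp_le)

text \<open>The points with \<open>x \<noteq> 0\<close> on the curve \<open>y\<^sup>2 = x\<^sup>3 + (a x + b)\<^sup>2\<close> correspond to the triples \<open>(P, Q, R)\<close> with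
\<open>P + Q + R = 2 a\<close> and \<open>P Q R = 2 b\<close>, namely \<open>P = - 2 b / x\<close>, \<open>Q = (y + a x + b) / x\<close> and
\<open>R = (a x + b - y) / x\<close>. For given \<open>P\<close> the equation for \<open>Q\<close> is quadratic, and the substitution
\<open>P x = - 2 b\<close> turns its discriminant into the cubic times a square.\<close>

lemma card_rotation_set:
  assumes b: "\<not> int p dvd b"
  shows "int (card {(P, Q). P \<in> residues_mod \<and> Q \<in> residues_mod \<and>
            [P * Q * (2 * a - P - Q) = 2 * b] (mod int p)}) =
         int p - 2 + (\<Sum>x\<in>residues_mod. chi (x ^ 3 + (a * x + b)\<^sup>2))"
proof -
  let ?W = "{(P, Q). P \<in> residues_mod \<and> Q \<in> residues_mod \<and>
            [P * Q * (2 * a - P - Q) = 2 * b] (mod int p)}"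
  let ?D = "\<lambda>P. (P * (2 * a - P))\<^sup>2 - 8 * b * P"
  let ?f = "\<lambda>x. x ^ 3 + (a * x + b)\<^sup>2"
  have W: "?W = (SIGMA P:residues_mod. {Q\<in>residues_mod. [P * Q * (2 * a - P - Q) = 2 * b] (mod int p)})"
    by auto
  have fib0: "int (card {Q\<in>residues_mod. [0 * Q * (2 * a - 0 - Q) = 2 * b] (mod int p)}) = 0"
  proof -
    have "\<not> [0 = 2 * b] (mod int p)"
      using b not_dvd_2 prime_int by (metis cong_0_iff cong_sym prime_dvd_mult_iff)
    then show ?thesis by simp
  qed
  have fib: "int (card {Q\<in>residues_mod. [P * Q * (2 * a - P - Q) = 2 * b] (mod int p)}) = 1 + chi (?D P)"
    if P: "P \<in> {1..<int p}" for P
  proof -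
    have nP: "\<not> int p dvd 2 * P"
      using not_dvd_pos_residue[OF P] not_dvd_2 prime_int by (simp add: prime_dvd_mult_iff)
    then have n4P: "\<not> int p dvd - 4 * P"
      using not_dvd_pos_residue[OF P] not_dvd_2 prime_int
      by (metis mult_2 mult_2_right mult_minus_left dvd_minus_iff numeral_Bit0 prime_dvd_mult_iff)
    let ?g = "\<lambda>Q. 2 * P * Q - P * (2 * a - P)"
    have "[P * Q * (2 * a - P - Q) = 2 * b] (mod int p) \<longleftrightarrow> [(?g Q)\<^sup>2 = ?D P] (mod int p)" for Q
    proof -
      have "[P * Q * (2 * a - P - Q) = 2 * b] (mod int p) \<longleftrightarrow>
          [- 4 * P * (P * Q * (2 * a - P - Q)) = - 4 * P * (2 * b)] (mod int p)"
        by (rule mult_cancel_cong[OF n4P, symmetric])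
      also have "\<dots> \<longleftrightarrow> [(?g Q)\<^sup>2 = ?D P] (mod int p)"
      proof -
        have "- 4 * P * (P * Q * (2 * a - P - Q)) - (- 4 * P * (2 * b)) = (?g Q)\<^sup>2 - ?D P"
          by (simp add: algebra_simps power2_eq_square)
        then show ?thesis by (simp only: cong_iff_dvd_diff)
      qed
      finally show ?thesis .
    qed
    then have "int (card {Q\<in>residues_mod. [P * Q * (2 * a - P - Q) = 2 * b] (mod int p)}) =
        (\<Sum>Q\<in>residues_mod. if [(?g Q)\<^sup>2 = ?D P] (mod int p) then 1 else 0)"
      unfolding card_residues_eq_sum by simp
    also have "\<dots> = (\<Sum>Q\<in>residues_mod. if [Q\<^sup>2 = ?D P] (mod int p) then 1 else 0)"
    proof (rule sum_residues_reindex[where f = "\<lambda>y. if [y\<^sup>2 = ?D P] (mod int p) then 1 else 0"])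
      fix x :: int
      show "(if [(x mod int p)\<^sup>2 = ?D P] (mod int p) then 1 else 0) =
          (if [x\<^sup>2 = ?D P] (mod int p) then 1 else (0::int))"
        by (simp add: cong_def power_mod)
    next
      fix x y :: int
      assume "[?g x = ?g y] (mod int p)"
      then have "[2 * P * x = 2 * P * y] (mod int p)"
        by (simp add: cong_iff_dvd_diff)
      then show "[x = y] (mod int p)" using mult_cancel_cong[OF nP] by blast
    qed
    also have "\<dots> = 1 + chi (?D P)"
      using card_square_roots[of "?D P"] unfolding card_residues_eq_sum .
    finally show ?thesis .
  qed
  have "int (card ?W) = (\<Sum>P\<in>residues_mod. int (card {Q\<in>residues_mod. [P * Q * (2 * a - P - Q) = 2 * b] (mod int p)}))"
    unfolding W by (subst card_SigmaI) auto
  also have "\<dots> = (\<Sum>P\<in>{1..<int p}. 1 + chi (?D P))"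
    using fib fib0 unfolding residues_eq_insert by simp
  also have "\<dots> = int p - 1 + (\<Sum>P\<in>{1..<int p}. chi (?D P))"
    using p_gt_2 by (simp add: sum.distrib)
  also have "(\<Sum>P\<in>{1..<int p}. chi (?D P)) = (\<Sum>x\<in>{1..<int p}. chi (?f x))"
  proof -
    \<comment> \<open>\<open>P ^ (p - 2)\<close> is the inverse of \<open>P\<close> modulo \<open>p\<close>, so \<open>P * ?h P\<close> is \<open>- 2 * b\<close>\<close>
    let ?h = "\<lambda>P. (- 2 * b * P ^ (p - 2)) mod int p"
    have hP: "[P * ?h P = - 2 * b] (mod int p)" if "P \<in> {1..<int p}" for P
    proof -
      have "[P * ?h P = P * (- 2 * b * P ^ (p - 2))] (mod int p)"
        by (intro cong_mult) (auto simp: cong_def)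
      also have "P * (- 2 * b * P ^ (p - 2)) = - 2 * b * P ^ (p - 1)"
      proof -
        have "p - 1 = Suc (p - 2)" using p_gt_2 by simp
        then have "P ^ (p - 1) = P * P ^ (p - 2)" by (metis power_Suc)
        then show ?thesis by (simp add: ac_simps)
      qed
      also have "[\<dots> = - 2 * b * 1] (mod int p)"
        by (intro cong_mult fermat_cong not_dvd_pos_residue that cong_refl)
      finally show ?thesis by simp
    qed
    have n2b: "\<not> int p dvd - 2 * b"
      using b not_dvd_2 prime_int by (simp add: prime_dvd_mult_iff)
    have h_in: "?h P \<in> {1..<int p}" if "P \<in> {1..<int p}" for P
    proof -
      have "?h P \<noteq> 0"
      proof
        assume "?h P = 0"
        then have "[0 = - 2 * b] (mod int p)" using hP[OF that] by simp
        then show False using n2b by (metis cong_0_iff cong_sym)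
      qed
      moreover have "?h P \<in> residues_mod" by simp
      ultimately show ?thesis unfolding residues_eq_insert by blast
    qed
    have inj: "inj_on ?h {1..<int p}"
    proof (rule inj_onI)
      fix P Q assume P: "P \<in> {1..<int p}" and Q: "Q \<in> {1..<int p}" and e: "?h P = ?h Q"
      have "[P * ?h P = Q * ?h P] (mod int p)"
        using hP[OF P] hP[OF Q] unfolding e by (metis cong_sym cong_trans)
      then have "[?h P * P = ?h P * Q] (mod int p)" by (simp only: mult.commute)
      then have "[P = Q] (mod int p)"
        using mult_cancel_cong[OF not_dvd_pos_residue[OF h_in[OF P]]] by blast
      then show "P = Q" using P Q residues_cong_iff[of P Q] by (auto simp: residues_eq_insert)
    qed
    have "bij_betw ?h {1..<int p} {1..<int p}"
      unfolding bij_betw_def using inj h_in by (intro conjI inj endo_inj_surj) auto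
    then have "(\<Sum>x\<in>{1..<int p}. chi (?f x)) = (\<Sum>P\<in>{1..<int p}. chi (?f (?h P)))"
      by (rule sum.reindex_bij_betw[symmetric])
    also have "\<dots> = (\<Sum>P\<in>{1..<int p}. chi (?D P))"
    proof (rule sum.cong[OF refl])
      fix P assume P: "P \<in> {1..<int p}"
      define x where "x = ?h P"
      have Px: "[P * x = - 2 * b] (mod int p)" using hP[OF P] by (simp only: x_def)
      have nx: "\<not> int p dvd x" unfolding x_def by (rule not_dvd_pos_residue[OF h_in[OF P]])
      have "x ^ 4 * ?D P = (P * x)\<^sup>2 * (2 * a * x - P * x)\<^sup>2 - 8 * b * (P * x) * x ^ 3"
        by (simp add: algebra_simps power2_eq_square power3_eq_cube eval_nat_numeral)
      also have "[\<dots> = (- 2 * b)\<^sup>2 * (2 * a * x - (- 2 * b))\<^sup>2 - 8 * b * (- 2 * b) * x ^ 3] (mod int p)"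
        by (intro cong_diff cong_mult cong_pow Px cong_refl)
      also have "(- 2 * b)\<^sup>2 * (2 * a * x - (- 2 * b))\<^sup>2 - 8 * b * (- 2 * b) * x ^ 3 = (2 * 2 * b)\<^sup>2 * ?f x"
        by (simp add: algebra_simps power2_eq_square power3_eq_cube)
      finally have "chi (x ^ 4 * ?D P) = chi ((2 * 2 * b)\<^sup>2 * ?f x)" by (rule chi_cong)
      moreover have "chi (x ^ 4) = 1"
        using chi_square[of "x\<^sup>2"] nx prime_int by (simp add: prime_dvd_power_iff flip: power_mult)
      moreover have "chi ((2 * 2 * b)\<^sup>2) = 1"
        using b not_dvd_2 prime_int by (intro chi_square) (simp only: prime_dvd_mult_iff, simp)
      ultimately have "chi (?D P) = chi (?f x)" by (simp only: chi_mult) 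
      then show "chi (?f (?h P)) = chi (?D P)" by (simp only: x_def)
    qed
    finally show ?thesis ..
  qed
  also have "(\<Sum>x\<in>{1..<int p}. chi (?f x)) = (\<Sum>x\<in>residues_mod. chi (?f x)) - 1"
    using chi_square[OF b] unfolding residues_eq_insert by simp
  finally show ?thesis by simp
qed

text \<open>Rotating the triples \<open>(P, Q, R)\<close> is translation by a point of order three. The second hypothesis
excludes a fixed triple \<open>P = Q = R\<close>, which would come from a singular point.\<close>

lemma cubic_sum_mod_3:
  assumes b: "\<not> int p dvd b" and ab: "\<And>c. [3 * c = 2 * a] (mod int p) \<Longrightarrow> \<not> [c ^ 3 = 2 * b] (mod int p)"
  shows "3 dvd int p - 2 + (\<Sum>x\<in>residues_mod. chi (x ^ 3 + (a * x + b)\<^sup>2))"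
proof -
  let ?W = "{(P, Q). P \<in> residues_mod \<and> Q \<in> residues_mod \<and>
            [P * Q * (2 * a - P - Q) = 2 * b] (mod int p)}"
  let ?t = "\<lambda>(P, Q). (Q, (2 * a - P - Q) mod int p)"
  have fin: "finite ?W"
    by (rule finite_subset[of _ "residues_mod \<times> residues_mod"]) auto
  have "3 dvd card ?W"
  proof (rule three_dvd_card_of_order_3[where t = ?t, OF fin])
    fix z assume "z \<in> ?W"
    then obtain P Q where z: "z = (P, Q)" "P \<in> residues_mod" "Q \<in> residues_mod"
      "[P * Q * (2 * a - P - Q) = 2 * b] (mod int p)" by auto
    define R where "R = (2 * a - P - Q) mod int p"
    have R: "[R = 2 * a - P - Q] (mod int p)" "R \<in> residues_mod" by (auto simp: R_def cong_def)
    have tz: "?t z = (Q, R)" by (simp add: z R_def)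
    have R2: "[2 * a - Q - R = P] (mod int p)"
      using cong_diff[OF cong_refl R(1), of "2 * a - Q"] by simp
    have "[Q * R * (2 * a - Q - R) = Q * (2 * a - P - Q) * P] (mod int p)"
      by (intro cong_mult cong_refl R R2)
    also have "Q * (2 * a - P - Q) * P = P * Q * (2 * a - P - Q)" by simp
    also note z(4)
    finally have QR: "[Q * R * (2 * a - Q - R) = 2 * b] (mod int p)" .
    then show "?t z \<in> ?W" unfolding tz using z R by simp
    have P: "(2 * a - Q - R) mod int p = P"
      using R2 z(2) by (simp add: cong_def residues_mod_def)
    have Q: "(2 * a - R - P) mod int p = Q"
    proof -
      have "[2 * a - R - P = 2 * a - (2 * a - P - Q) - P] (mod int p)"
        by (intro cong_diff cong_refl R)
      then show ?thesis using z(3) by (simp add: cong_def residues_mod_def)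
    qed
    show "?t (?t (?t z)) = z" unfolding tz by (simp add: P Q z(1))
    show "?t z \<noteq> z"
    proof
      assume "?t z = z"
      then have e: "Q = P" "R = P" using tz z(1) by auto
      have "[3 * P = 2 * a] (mod int p)"
        using R(1) unfolding e by (simp add: cong_iff_dvd_diff algebra_simps)
      moreover have "[P ^ 3 = 2 * b] (mod int p)"
      proof -
        have "[P * P * P = P * P * (2 * a - P - P)] (mod int p)"
          using R(1) unfolding e by (intro cong_mult cong_refl)
        also have "[P * P * (2 * a - P - P) = 2 * b] (mod int p)" using z(4) unfolding e .
        finally show ?thesis by (simp add: power3_eq_cube)
      qed
      ultimately show False using ab by blast
    qed
  qed
  then have "3 dvd int (card ?W)" by presburger
  then show ?thesis unfolding card_rotation_set[OF b] .
qed

text \<open>The Jacobsthal sum is minus the trace of Frobenius of \<open>y\<^sup>2 = x\<^sup>3 - k x\<close>.\<close>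

definition jacobsthal :: "int \<Rightarrow> int" where
  "jacobsthal k = (\<Sum>x\<in>residues_mod. chi (x ^ 3 - k * x))"

lemma jacobsthal_cong: "[k = l] (mod int p) \<Longrightarrow> jacobsthal k = jacobsthal l"
  unfolding jacobsthal_def by (intro sum.cong refl chi_cong cong_diff cong_mult cong_refl)

lemma jacobsthal_scale:
  assumes "\<not> int p dvd u"
  shows "jacobsthal (k * u\<^sup>2) = chi u * jacobsthal k"
proof -
  have "jacobsthal (k * u\<^sup>2) = (\<Sum>x\<in>residues_mod. chi ((u * x) ^ 3 - k * u\<^sup>2 * (u * x)))"
    unfolding jacobsthal_def
    by (rule sum_residues_scale[where f = "\<lambda>x. chi (x ^ 3 - k * u\<^sup>2 * x)", symmetric])
      (use assms in \<open>auto intro!: chi_cong cong_diff cong_mult cong_pow simp: cong_def\<close>)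
  also have "\<dots> = (\<Sum>x\<in>residues_mod. chi (u ^ 3 * (x ^ 3 - k * x)))"
    by (intro sum.cong refl arg_cong[where f = chi])
      (simp add: algebra_simps power2_eq_square power3_eq_cube)
  also have "\<dots> = chi u * jacobsthal k"
    by (simp add: chi_mult chi_cube jacobsthal_def sum_distrib_left)
  finally show ?thesis .
qed

lemma jacobsthal_0: "jacobsthal 0 = 0"
  by (simp add: jacobsthal_def chi_cube sum_chi)

lemma jacobsthal_square_eq:
  assumes "chi (k * l) = 1"
  shows "(jacobsthal k)\<^sup>2 = (jacobsthal l)\<^sup>2"
proof -
  have n: "\<not> int p dvd k" "\<not> int p dvd l" 
    using assms chi_eq_0_iff[of "k * l"] by auto
  obtain w where w: "[w\<^sup>2 = k * l] (mod int p)"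
    using assms by (auto simp: Legendre_def QuadRes_def split: if_splits)
  obtain v where v: "[l * v = 1] (mod int p)" using inverse_mod_exists n by metis
  define u where "u = w * v"
  have "l * u\<^sup>2 = w\<^sup>2 * (l * v) * v" by (simp add: u_def power2_eq_square)
  also have "[\<dots> = k * l * 1 * v] (mod int p)" by (intro cong_mult w v cong_refl)
  also have "k * l * 1 * v = k * (l * v)" by simp
  also have "[\<dots> = k * 1] (mod int p)" by (intro cong_mult v cong_refl)
  finally have lu: "[l * u\<^sup>2 = k] (mod int p)" by simp
  have nu: "\<not> int p dvd u"
  proof
    assume "int p dvd u"
    then have "int p dvd l * u\<^sup>2" by (simp add: power2_eq_square)
    then show False using lu n(1) by (metis cong_dvd_iff)
  qed
  have "jacobsthal k = chi u * jacobsthal l"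
    using jacobsthal_scale[OF nu, of l] jacobsthal_cong[OF lu] by simp
  moreover have "chi u = 1 \<or> chi u = -1" using nu chi_cases[of u] by (auto simp: chi_eq_0_iff)
  ultimately show ?thesis by auto
qed

lemma sum_jacobsthal_square:
  assumes "chi (- 1) = 1"
  shows "(\<Sum>k\<in>residues_mod. (jacobsthal k)\<^sup>2) = 2 * int p * (int p - 1)"
proof -
  let ?R = residues_mod
  have "(\<Sum>k\<in>?R. (jacobsthal k)\<^sup>2) =
      (\<Sum>k\<in>?R. \<Sum>x\<in>?R. \<Sum>y\<in>?R. chi (x * y) * chi ((k - x\<^sup>2) * (k - y\<^sup>2)))"
  proof (rule sum.cong[OF refl])
    fix k
    have "(jacobsthal k)\<^sup>2 = (\<Sum>x\<in>?R. \<Sum>y\<in>?R. chi (x ^ 3 - k * x) * chi (y ^ 3 - k * y))"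
      by (simp add: jacobsthal_def power2_eq_square sum_product)
    also have "\<dots> = (\<Sum>x\<in>?R. \<Sum>y\<in>?R. chi (x * y) * chi ((k - x\<^sup>2) * (k - y\<^sup>2)))"
    proof (intro sum.cong refl)
      fix x y
      have "(x ^ 3 - k * x) * (y ^ 3 - k * y) = (x * y) * ((k - x\<^sup>2) * (k - y\<^sup>2))"
        by (simp add: algebra_simps power2_eq_square power3_eq_cube)
      then show "chi (x ^ 3 - k * x) * chi (y ^ 3 - k * y) = chi (x * y) * chi ((k - x\<^sup>2) * (k - y\<^sup>2))"
        by (metis chi_mult)
    qed
    finally show "(jacobsthal k)\<^sup>2 = (\<Sum>x\<in>?R. \<Sum>y\<in>?R. chi (x * y) * chi ((k - x\<^sup>2) * (k - y\<^sup>2)))" .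
  qed
  also have "\<dots> = (\<Sum>x\<in>?R. \<Sum>k\<in>?R. \<Sum>y\<in>?R. chi (x * y) * chi ((k - x\<^sup>2) * (k - y\<^sup>2)))"
    by (rule sum.swap)
  also have "\<dots> = (\<Sum>x\<in>?R. \<Sum>y\<in>?R. \<Sum>k\<in>?R. chi (x * y) * chi ((k - x\<^sup>2) * (k - y\<^sup>2)))"
    by (intro sum.cong refl sum.swap)
  also have "\<dots> = (\<Sum>x\<in>?R. \<Sum>y\<in>?R. (if [x\<^sup>2 = y\<^sup>2] (mod int p) then int p * chi (x * y) else 0) - chi x * chi y)"
  proof (intro sum.cong refl)
    fix x y
    have "(\<Sum>k\<in>?R. chi (x * y) * chi ((k - x\<^sup>2) * (k - y\<^sup>2))) =
        chi (x * y) * (if [x\<^sup>2 = y\<^sup>2] (mod int p) then int p - 1 else - 1)"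
      by (simp only: sum_distrib_left[symmetric] sum_chi_quadratic)
    then show "(\<Sum>k\<in>?R. chi (x * y) * chi ((k - x\<^sup>2) * (k - y\<^sup>2))) =
        (if [x\<^sup>2 = y\<^sup>2] (mod int p) then int p * chi (x * y) else 0) - chi x * chi y"
      by (simp add: chi_mult algebra_simps)
  qed
  also have "\<dots> = (\<Sum>x\<in>?R. \<Sum>y\<in>?R. if [x\<^sup>2 = y\<^sup>2] (mod int p) then int p * chi (x * y) else 0)"
    by (simp add: sum_subtractf sum_product[symmetric] sum_chi)
  also have "\<dots> = (\<Sum>x\<in>?R. if x = 0 then 0 else 2 * int p)"
  proof (rule sum.cong[OF refl])
    fix x assume x: "x \<in> ?R"
    show "(\<Sum>y\<in>?R. if [x\<^sup>2 = y\<^sup>2] (mod int p) then int p * chi (x * y) else 0) = (if x = 0 then 0 else 2 * int p)"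
    proof (cases "x = 0")
      case False
      with x have x1: "x \<in> {1..<int p}" by (simp add: residues_mod_def)
      then have nx: "\<not> int p dvd x" by (rule not_dvd_pos_residue)
      have iff: "[x\<^sup>2 = y\<^sup>2] (mod int p) \<longleftrightarrow> y = x \<or> y = int p - x" if "y \<in> ?R" for y
      proof -
        have "[x\<^sup>2 = y\<^sup>2] (mod int p) \<longleftrightarrow> int p dvd (y - x) * (y - (int p - x))"
        proof -
          have "y\<^sup>2 - x\<^sup>2 = (y - x) * (y - (int p - x)) + int p * (y - x)"
            by (simp add: algebra_simps power2_eq_square)
          then have "int p dvd y\<^sup>2 - x\<^sup>2 \<longleftrightarrow> int p dvd (y - x) * (y - (int p - x))"
            by (simp add: dvd_add_left_iff)
          then show ?thesis by (metis cong_iff_dvd_diff cong_sym_eq)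
        qed
        also have "\<dots> \<longleftrightarrow> [y = x] (mod int p) \<or> [y = int p - x] (mod int p)"
          using prime_int by (simp only: prime_dvd_mult_iff cong_iff_dvd_diff)
        also have "\<dots> \<longleftrightarrow> y = x \<or> y = int p - x"
          using that x1 by (subst (1 2) residues_cong_iff) (auto simp: residues_mod_def)
        finally show ?thesis .
      qed
      have "(\<Sum>y\<in>?R. if [x\<^sup>2 = y\<^sup>2] (mod int p) then int p * chi (x * y) else 0) =
          (\<Sum>y\<in>{x, int p - x}. int p * chi (x * y))"
        by (rule sum.mono_neutral_cong_right)
          (use x1 iff in \<open>auto simp: residues_mod_def\<close>)
      also have "\<dots> = int p * chi (x * x) + int p * chi (x * (int p - x))"
      proof -
        have "x \<noteq> int p - x" using odd_p by presburger
        then show ?thesis by simp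
      qed
      also have "chi (x * (int p - x)) = chi (x * x)"
      proof -
        have "chi (x * (int p - x)) = chi ((- 1) * (x * x))"
          by (rule chi_cong) (simp add: cong_iff_dvd_diff algebra_simps)
        then show ?thesis by (simp only: chi_mult assms)
      qed
      also have "chi (x * x) = 1" using chi_square[OF nx] by (simp add: power2_eq_square)
      finally show ?thesis using False by simp
    next
      case True
      then show ?thesis by (auto intro!: sum.neutral)
    qed
  qed
  also have "\<dots> = 2 * int p * (int p - 1)"
    using p_gt_2 unfolding residues_eq_insert by simp
  finally show ?thesis .
qed

text \<open>The square of a Jacobsthal sum only depends on the quadratic character of \<open>k\<close>, so that the identity
follows from the second moment of all Jacobsthal sums.\<close>

lemma jacobsthal_identity:
  assumes "chi (- 1) = 1" "\<not> int p dvd k" "chi g = - 1"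
  shows "(jacobsthal k)\<^sup>2 + (jacobsthal (g * k))\<^sup>2 = 4 * int p"
proof -
  let ?A = "(jacobsthal k)\<^sup>2" and ?B = "(jacobsthal (g * k))\<^sup>2"
  have "2 * (jacobsthal l)\<^sup>2 = (?A + ?B) + chi (l * k) * (?A - ?B) - (if l = 0 then ?A + ?B else 0)"
    if l: "l \<in> residues_mod" for l
  proof (cases "l = 0")
    case False
    with l have "\<not> int p dvd l" by (intro not_dvd_pos_residue) (simp add: residues_mod_def)
    with assms(2) have "chi l \<noteq> 0" "chi k \<noteq> 0" by (simp_all add: chi_eq_0_iff)
    then consider "chi (l * k) = 1" | "chi (l * k) = - 1"
      using chi_cases[of l] chi_cases[of k] by (auto simp: chi_mult)
    then show ?thesis
    proof cases
      case 1
      then show ?thesis using jacobsthal_square_eq[of l k] False by simp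
    next
      case 2
      then have "chi (l * (g * k)) = 1" using assms(3) by (simp add: chi_mult)
      then show ?thesis using jacobsthal_square_eq[of l "g * k"] 2 False by simp
    qed
  qed (simp add: jacobsthal_0)
  then have "(\<Sum>l\<in>residues_mod. 2 * (jacobsthal l)\<^sup>2) =
      (\<Sum>l\<in>residues_mod. (?A + ?B) + chi (l * k) * (?A - ?B) - (if l = 0 then ?A + ?B else 0))"
    by (intro sum.cong refl)
  also have "\<dots> = int p * (?A + ?B) + (\<Sum>l\<in>residues_mod. chi (l * k)) * (?A - ?B) - (?A + ?B)"
  proof -
    have "0 \<in> residues_mod" using p_gt_2 by (simp add: residues_mod_def)
    then show ?thesis by (simp add: sum.distrib sum_subtractf sum_distrib_right)
  qed
  also have "(\<Sum>l\<in>residues_mod. chi (l * k)) = 0"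
    by (simp add: chi_mult sum_distrib_right[symmetric] sum_chi)
  finally have "2 * (2 * int p * (int p - 1)) = (int p - 1) * (?A + ?B)"
    using sum_jacobsthal_square[OF assms(1)] by (simp add: sum_distrib_left[symmetric] algebra_simps)
  then have "(int p - 1) * (4 * int p) = (int p - 1) * (?A + ?B)" by (simp add: algebra_simps)
  then show ?thesis using p_gt_2 by simp
qed

end

section \<open>Clausen's identity modulo the square of a prime\<close>

text \<open>The numbers \<open>(4 k)! / ((2 k)! (k!)\<^sup>2)\<close>; up to the factor \<open>64 ^ k\<close> they are the coefficients of the
hypergeometric series with parameters \<open>1/4, 3/4; 1\<close>.\<close>

definition quartic_coeff :: "nat \<Rightarrow> nat" where
  "quartic_coeff k = ((2 * k) choose k) * ((4 * k) choose (2 * k))"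

lemma fact_quartic_coeff: "quartic_coeff k * (fact k * fact k * fact (2 * k)) = (fact (4 * k) :: nat)"
proof -
  have "fact k * fact k * ((2 * k) choose k) = (fact (2 * k) :: nat)"
    using binomial_fact_lemma[of k "2 * k"] by simp
  moreover have "fact (2 * k) * fact (2 * k) * ((4 * k) choose (2 * k)) = (fact (4 * k) :: nat)"
    using binomial_fact_lemma[of "2 * k" "4 * k"] by simp
  ultimately show ?thesis unfolding quartic_coeff_def by (metis (no_types, lifting) mult.assoc mult.commute)
qed

lemma quartic_coeff_Suc:
  "(int k + 1)\<^sup>2 * int (quartic_coeff (Suc k)) = 4 * (4 * int k + 1) * (4 * int k + 3) * int (quartic_coeff k)"
proof -
  have f: "int (quartic_coeff j) * (fact j * fact j * fact (2 * j)) = fact (4 * j)" for j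
    using arg_cong[OF fact_quartic_coeff[of j], of int] by simp
  have e4: "fact (4 * Suc k) = (4 * int k + 4) * (4 * int k + 3) * (4 * int k + 2) * (4 * int k + 1) * fact (4 * k)"
    by (simp add: eval_nat_numeral algebra_simps)
  have e2: "fact (2 * Suc k) = (2 * int k + 2) * (2 * int k + 1) * fact (2 * k)"
    by (simp add: eval_nat_numeral algebra_simps)
  have e1: "fact (Suc k) = (int k + 1) * fact k" by simp
  define a :: int where "a = fact k * fact k * fact (2 * k) * ((2 * int k + 2) * (2 * int k + 1))"
  have "a * ((int k + 1)\<^sup>2 * int (quartic_coeff (Suc k))) = fact (4 * Suc k)"
    using f[of "Suc k"] unfolding e1 e2 a_def by (simp add: power2_eq_square ac_simps)
  also have "\<dots> = a * (4 * (4 * int k + 1) * (4 * int k + 3) * int (quartic_coeff k))"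
    unfolding e4 f[of k, symmetric] a_def by (simp add: algebra_simps)
  finally show ?thesis by (simp add: a_def)
qed

lemma central_binomial_Suc:
  "(int k + 1) * int ((2 * Suc k) choose (Suc k)) = 2 * (2 * int k + 1) * int ((2 * k) choose k)"
proof -
  have f: "int ((2 * j) choose j) * (fact j * fact j) = fact (2 * j)" for j
    using arg_cong[OF binomial_fact_lemma[of j "2 * j"], of int] by (simp add: ac_simps)
  have e2: "fact (2 * Suc k) = (2 * int k + 2) * (2 * int k + 1) * fact (2 * k)"
    by (simp add: eval_nat_numeral algebra_simps)
  have e1: "fact (Suc k) = (int k + 1) * fact k" by simp
  define a :: int where "a = fact k * fact k * (int k + 1)"
  have "a * ((int k + 1) * int ((2 * Suc k) choose (Suc k))) = fact (2 * Suc k)"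
    using f[of "Suc k"] unfolding e1 a_def by (simp only: ac_simps)
  also have "\<dots> = a * (2 * (2 * int k + 1) * int ((2 * k) choose k))"
    unfolding e2 f[of k, symmetric] a_def by (simp add: algebra_simps)
  finally show ?thesis by (simp add: a_def)
qed

text \<open>The two sides of Clausen's identity are the square of \<open>quartic_fps\<close> and the series \<open>quartic_fps3\<close>
composed with the quadratic polynomial \<open>quad_fps\<close>.\<close>

definition quartic_fps :: "int fps" where
  "quartic_fps = Abs_fps (\<lambda>k. int (quartic_coeff k))"

definition quartic_fps3 :: "int fps" where
  "quartic_fps3 = Abs_fps (\<lambda>k. int ((2 * k) choose k) * int (quartic_coeff k))"

definition quad_fps :: "int fps" where
  "quad_fps = fps_X - fps_const 64 * fps_X\<^sup>2"

lemma quartic_fps_ode: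
  "quad_fps * fps_deriv (fps_deriv quartic_fps) + fps_deriv quad_fps * fps_deriv quartic_fps
     = fps_const 12 * quartic_fps" (is "?L = ?R")
proof (rule fps_ext)
  fix n
  let ?F = quartic_fps
  have L: "?L = fps_X * fps_deriv (fps_deriv ?F) - fps_const 64 * (fps_X * (fps_X * fps_deriv (fps_deriv ?F)))
       + fps_deriv ?F - fps_const 128 * (fps_X * fps_deriv ?F)"
    by (simp add: quad_fps_def power2_eq_square algebra_simps flip: fps_const_mult fps_const_add)
  have r: "(int n + 1)\<^sup>2 * int (quartic_coeff (Suc n)) =
      4 * (4 * int n + 1) * (4 * int n + 3) * int (quartic_coeff n)" by (rule quartic_coeff_Suc)
  show "?L $ n = ?R $ n"
    unfolding L
    using r by (cases n; cases "n - 1") (auto simp: quartic_fps_def algebra_simps power2_eq_square)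
qed

lemma quartic_fps3_ode:
  "(fps_X\<^sup>2 - fps_const 256 * fps_X ^ 3) * fps_deriv (fps_deriv (fps_deriv quartic_fps3))
    + (fps_const 3 * fps_X - fps_const 1152 * fps_X\<^sup>2) * fps_deriv (fps_deriv quartic_fps3)
    + (1 - fps_const 816 * fps_X) * fps_deriv quartic_fps3 - fps_const 24 * quartic_fps3 = 0" (is "?L = 0")
proof (rule fps_ext)
  fix n
  let ?G = quartic_fps3
  have L: "?L = fps_X * (fps_X * fps_deriv (fps_deriv (fps_deriv ?G)))
      - fps_const 256 * (fps_X * (fps_X * (fps_X * fps_deriv (fps_deriv (fps_deriv ?G)))))
      + fps_const 3 * (fps_X * fps_deriv (fps_deriv ?G))
      - fps_const 1152 * (fps_X * (fps_X * fps_deriv (fps_deriv ?G)))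
      + fps_deriv ?G - fps_const 816 * (fps_X * fps_deriv ?G) - fps_const 24 * ?G"
    by (simp add: power2_eq_square power3_eq_cube algebra_simps)
  define b where "b k = int ((2 * k) choose k)" for k
  define c where "c k = int (quartic_coeff k)" for k
  have r: "(int n + 1) ^ 3 * (b (Suc n) * c (Suc n)) =
      (2 * (2 * int n + 1) * b n) * (4 * (4 * int n + 1) * (4 * int n + 3) * c n)"
    using quartic_coeff_Suc[of n] central_binomial_Suc[of n] unfolding b_def[symmetric] c_def[symmetric]
    by (metis (no_types, lifting) mult.assoc mult.left_commute power2_eq_square power3_eq_cube)
  define g where "g k = b k * c k" for k
  have G: "?G $ k = g k" for k by (simp add: quartic_fps3_def g_def b_def c_def)
  have r: "(int n + 1) ^ 3 * g (Suc n) = 8 * (2 * int n + 1) * (4 * int n + 1) * (4 * int n + 3) * g n"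
    using r by (simp add: g_def algebra_simps)
  consider "n = 0" | "n = Suc 0" | "n = Suc (Suc 0)" | k where "n = Suc (Suc (Suc k))"
    by (metis not0_implies_Suc)
  then show "?L $ n = 0 $ n"
    unfolding L using r by cases (simp_all add: G algebra_simps power2_eq_square power3_eq_cube)
qed

text \<open>The differential equation is the symmetric square of that of \<open>quartic_fps\<close>. Comparing coefficients of
\<open>X ^ m\<close> expresses \<open>(m + 1) ^ 3 * Y $ (m + 1)\<close> by earlier coefficients.\<close>

lemma symmetric_square_ode_unique:
  fixes Y :: "int fps"
  assumes ode: "quad_fps\<^sup>2 * fps_deriv (fps_deriv (fps_deriv Y))
      + fps_const 3 * quad_fps * fps_deriv quad_fps * fps_deriv (fps_deriv Y)
      + ((fps_deriv quad_fps)\<^sup>2 - fps_const 176 * quad_fps) * fps_deriv Y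
      - fps_const 24 * fps_deriv quad_fps * Y = 0" (is "?L = 0")
    and "Y $ 0 = 0"
  shows "Y = 0"
proof -
  let ?D = fps_deriv and ?x = "\<lambda>f. fps_X * f"
  have dq: "fps_deriv quad_fps = 1 - fps_const 128 * fps_X"
    by (simp add: quad_fps_def power2_eq_square algebra_simps flip: fps_const_mult fps_const_add)
  have q2: "quad_fps\<^sup>2 = ?x (?x 1) - fps_const 128 * ?x (?x (?x 1)) + fps_const 4096 * ?x (?x (?x (?x 1)))"
    unfolding quad_fps_def by (simp add: power2_eq_square algebra_simps)
  have qd: "quad_fps * ?D quad_fps = ?x 1 - fps_const 192 * ?x (?x 1) + fps_const 8192 * ?x (?x (?x 1))"
    unfolding dq unfolding quad_fps_def by (simp add: power2_eq_square algebra_simps)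
  have dd: "(?D quad_fps)\<^sup>2 - fps_const 176 * quad_fps = 1 - fps_const 432 * ?x 1 + fps_const 27648 * ?x (?x 1)"
    unfolding dq unfolding quad_fps_def by (simp add: power2_eq_square algebra_simps)
  have "?L = ?x (?x (?D (?D (?D Y)))) - fps_const 128 * ?x (?x (?x (?D (?D (?D Y)))))
      + fps_const 4096 * ?x (?x (?x (?x (?D (?D (?D Y))))))
      + fps_const 3 * ?x (?D (?D Y)) - fps_const 576 * ?x (?x (?D (?D Y)))
      + fps_const 24576 * ?x (?x (?x (?D (?D Y))))
      + ?D Y - fps_const 432 * ?x (?D Y) + fps_const 27648 * ?x (?x (?D Y))
      - fps_const 24 * Y + fps_const 3072 * ?x Y"
    unfolding q2 dd mult.assoc[of "fps_const 3"] qd unfolding dq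
    by (simp add: algebra_simps)
  with ode have L: "\<dots> = 0" by simp
  have "Y $ n = 0" for n
  proof (induction n rule: less_induct)
    case (less n)
    show ?case
    proof (cases n)
      case (Suc m)
      have Ym: "Y $ m = 0" "m \<noteq> 0 \<Longrightarrow> Y $ (m - 1) = 0" using less Suc by auto
      consider "m = 0" | "m = Suc 0" | "m = Suc (Suc 0)" | "m = Suc (Suc (Suc 0))" | k where "m = Suc (Suc (Suc (Suc k)))"
        by (metis not0_implies_Suc)
      then have "(int m + 1) ^ 3 * Y $ Suc m = 0"
      proof cases
        case 1
        then show ?thesis using arg_cong[OF L, of "\<lambda>f. f $ m"] Ym by simp
      next
        case 2
        then show ?thesis using arg_cong[OF L, of "\<lambda>f. f $ m"] Ym by simp
      next
        case 3
        then show ?thesis using arg_cong[OF L, of "\<lambda>f. f $ m"] Ym by simp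
      next
        case 4
        then show ?thesis using arg_cong[OF L, of "\<lambda>f. f $ m"] Ym by simp
      next
        case (5 k)
        then show ?thesis using arg_cong[OF L, of "\<lambda>f. f $ m"] Ym
          by (simp add: algebra_simps power3_eq_cube)
      qed
      then show ?thesis using Suc by simp
    qed (use assms(2) in simp)
  qed
  then show ?thesis by (simp add: fps_eq_iff)
qed


lemma quad_fps_0 [simp]: "quad_fps $ 0 = 0"
  by (simp add: quad_fps_def)

lemma deriv_quad_fps: "fps_deriv quad_fps = 1 - fps_const 128 * fps_X"
  by (simp add: quad_fps_def power2_eq_square algebra_simps flip: fps_const_mult fps_const_add)

lemma deriv_quad_fps_square: "(fps_deriv quad_fps)\<^sup>2 = 1 - 256 * quad_fps"
  unfolding deriv_quad_fps
  by (simp add: quad_fps_def power2_eq_square algebra_simps numeral_fps_const)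

lemma clausen_fps: "quartic_fps3 oo quad_fps = quartic_fps\<^sup>2"
proof -
  define p where "p = quad_fps"
  define q where "q = fps_deriv quad_fps"
  have p0: "p $ 0 = 0" by (simp add: p_def)
  have dp: "fps_deriv p = q" by (simp add: p_def q_def)
  have dq: "fps_deriv q = - 128" by (simp add: q_def deriv_quad_fps numeral_fps_const)
  have q2: "q\<^sup>2 = 1 - 256 * p" using deriv_quad_fps_square by (simp add: p_def q_def)
  let ?L = "\<lambda>Y. p\<^sup>2 * fps_deriv (fps_deriv (fps_deriv Y)) + 3 * p * q * fps_deriv (fps_deriv Y)
      + (q\<^sup>2 - 176 * p) * fps_deriv Y - 24 * q * Y"
  have L_square: "?L (quartic_fps\<^sup>2) = 0"
  proof -
    define F where "F = quartic_fps"
    define F1 where "F1 = fps_deriv F"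
    define F2 where "F2 = fps_deriv F1"
    define F3 where "F3 = fps_deriv F2"
    have ode: "p * F2 + q * F1 - 12 * F = 0"
      using quartic_fps_ode by (simp add: F_def F1_def F2_def p_def q_def numeral_fps_const)
    then have "fps_deriv (p * F2 + q * F1 - 12 * F) = 0" by simp
    then have ode': "p * F3 + 2 * q * F2 - 140 * F1 = 0"
      by (simp add: dp dq F1_def[symmetric] F2_def[symmetric] F3_def[symmetric] algebra_simps)
    have d1: "fps_deriv (F\<^sup>2) = 2 * F * F1"
      by (simp add: power2_eq_square F1_def algebra_simps)
    have d2: "fps_deriv (2 * F * F1) = 2 * F1\<^sup>2 + 2 * F * F2"
      by (simp add: power2_eq_square F1_def[symmetric] F2_def[symmetric] algebra_simps)
    have d3: "fps_deriv (2 * F1\<^sup>2 + 2 * F * F2) = 6 * F1 * F2 + 2 * F * F3"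
      by (simp add: power2_eq_square F1_def[symmetric] F2_def[symmetric] F3_def[symmetric] algebra_simps)
    have "?L (F\<^sup>2) = 2 * p * F * (p * F3 + 2 * q * F2 - 140 * F1)
        + (6 * p * F1 + 2 * q * F) * (p * F2 + q * F1 - 12 * F)"
      unfolding d1 d2 d3 by (simp add: algebra_simps power2_eq_square)
    then show ?thesis unfolding ode ode' by (simp add: F_def)
  qed
  have L_comp: "?L (quartic_fps3 oo p) = 0"
  proof -
    define G0 where "G0 = quartic_fps3 oo p"
    define G1 where "G1 = fps_deriv quartic_fps3 oo p"
    define G2 where "G2 = fps_deriv (fps_deriv quartic_fps3) oo p"
    define G3 where "G3 = fps_deriv (fps_deriv (fps_deriv quartic_fps3)) oo p"
    have "((fps_X\<^sup>2 - fps_const 256 * fps_X ^ 3) * fps_deriv (fps_deriv (fps_deriv quartic_fps3))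
    + (fps_const 3 * fps_X - fps_const 1152 * fps_X\<^sup>2) * fps_deriv (fps_deriv quartic_fps3)
    + (1 - fps_const 816 * fps_X) * fps_deriv quartic_fps3 - fps_const 24 * quartic_fps3) oo p = 0"
      unfolding quartic_fps3_ode by simp
    then have ode: "(p\<^sup>2 - 256 * p ^ 3) * G3 + (3 * p - 1152 * p\<^sup>2) * G2 + (1 - 816 * p) * G1 - 24 * G0 = 0"
      by (simp add: fps_compose_add_distrib fps_compose_sub_distrib fps_compose_mult_distrib[OF p0]
          fps_compose_power[OF p0, symmetric] p0 G0_def G1_def G2_def G3_def numeral_fps_const)
    have d1: "fps_deriv G0 = G1 * q" and d1': "fps_deriv G1 = G2 * q" and d1'': "fps_deriv G2 = G3 * q"
      by (simp_all add: G0_def G1_def G2_def G3_def fps_compose_deriv[OF p0] dp)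
    have d2: "fps_deriv (G1 * q) = G2 * q\<^sup>2 - 128 * G1"
      by (simp add: d1' dq power2_eq_square algebra_simps)
    have d3: "fps_deriv (G2 * q\<^sup>2 - 128 * G1) = G3 * q ^ 3 - 384 * q * G2"
      by (simp add: d1' d1'' dq power2_eq_square power3_eq_cube algebra_simps)
    have "?L G0 = q * (p\<^sup>2 * q\<^sup>2 * G3 + (3 * p * q\<^sup>2 - 384 * p\<^sup>2) * G2 + (q\<^sup>2 - 560 * p) * G1 - 24 * G0)"
      unfolding d1 d2 d3 by (simp add: algebra_simps power2_eq_square power3_eq_cube)
    also have "p\<^sup>2 * q\<^sup>2 * G3 + (3 * p * q\<^sup>2 - 384 * p\<^sup>2) * G2 + (q\<^sup>2 - 560 * p) * G1 - 24 * G0 =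
        (p\<^sup>2 - 256 * p ^ 3) * G3 + (3 * p - 1152 * p\<^sup>2) * G2 + (1 - 816 * p) * G1 - 24 * G0"
      unfolding q2 by (simp add: algebra_simps power2_eq_square power3_eq_cube)
    finally show ?thesis unfolding ode by (simp add: G0_def)
  qed
  have "(quartic_fps3 oo p) - quartic_fps\<^sup>2 = 0"
  proof (rule symmetric_square_ode_unique)
    let ?Y = "(quartic_fps3 oo p) - quartic_fps\<^sup>2"
    have "?L (A - B) = ?L A - ?L B" for A B
      unfolding fps_deriv_sub by (simp add: algebra_simps)
    from this[of "quartic_fps3 oo p" "quartic_fps\<^sup>2"] have "?L ?Y = 0"
      unfolding L_square L_comp by simp
    then show "quad_fps\<^sup>2 * fps_deriv (fps_deriv (fps_deriv ?Y))
      + fps_const 3 * quad_fps * fps_deriv quad_fps * fps_deriv (fps_deriv ?Y)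
      + ((fps_deriv quad_fps)\<^sup>2 - fps_const 176 * quad_fps) * fps_deriv ?Y
      - fps_const 24 * fps_deriv quad_fps * ?Y = 0"
      by (simp only: p_def q_def numeral_fps_const)
    show "?Y $ 0 = 0"
      by (simp add: quartic_fps3_def quartic_fps_def quartic_coeff_def power2_eq_square)
  qed
  then show ?thesis by (simp add: p_def)
qed

text \<open>The polynomial behind \<open>quad_fps\<close>.\<close>

definition quad_poly :: "int poly" where
  "quad_poly = [:0, 1, - 64:]"

lemma fps_of_quad_poly: "fps_of_poly quad_poly = quad_fps"
proof (rule fps_ext)
  fix n
  show "fps_of_poly quad_poly $ n = quad_fps $ n"
    by (cases n; cases "n - 1"; cases "n - 2")
      (auto simp: quad_poly_def quad_fps_def fps_X_power_nth coeff_pCons split: nat.splits)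
qed

lemma quad_poly_power_coeff_low: "m < i \<Longrightarrow> coeff (quad_poly ^ i) m = 0"
proof -
  have "quad_poly = monom 1 1 * [:1, -64:]"
    by (simp add: quad_poly_def monom_altdef)
  then have "quad_poly ^ i = monom 1 i * [:1, -64:] ^ i"
    by (metis power_mult_distrib monom_power power_one mult_1)
  then show "m < i \<Longrightarrow> coeff (quad_poly ^ i) m = 0"
    by (simp add: coeff_monom_mult)
qed

lemma quad_poly_power_coeff_high: "2 * i < m \<Longrightarrow> coeff (quad_poly ^ i) m = 0"
  by (rule coeff_eq_0) (simp add: degree_power_eq quad_poly_def)

lemma clausen_coeff:
  "(\<Sum>i\<le>m. int (quartic_coeff i) * int (quartic_coeff (m - i))) =
   (\<Sum>i\<le>m. int (((2 * i) choose i) * quartic_coeff i) * coeff (quad_poly ^ i) m)"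
proof -
  have "(quartic_fps\<^sup>2) $ m = (\<Sum>i\<le>m. int (quartic_coeff i) * int (quartic_coeff (m - i)))"
    by (simp add: power2_eq_square fps_mult_nth quartic_fps_def atLeast0AtMost)
  moreover have "(quartic_fps3 oo quad_fps) $ m =
      (\<Sum>i\<le>m. int (((2 * i) choose i) * quartic_coeff i) * coeff (quad_poly ^ i) m)"
    by (simp add: fps_compose_nth quartic_fps3_def atLeast0AtMost flip: fps_of_quad_poly fps_of_poly_power)
  ultimately show ?thesis by (simp add: clausen_fps)
qed


lemma prime_dvd_central_binomial:
  assumes "prime p" "j < p" "p \<le> 2 * j"
  shows "p dvd ((2 * j) choose j)"
proof -
  have "p dvd fact j * fact j * ((2 * j) choose j)"
    using binomial_fact_lemma[of j "2 * j"] assms prime_dvd_fact_iff[of p "2 * j"] by simp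
  then show ?thesis
    using assms by (simp add: prime_dvd_mult_iff prime_dvd_fact_iff)
qed

text \<open>Here \<open>p ^ 3\<close> divides \<open>(2 j)!\<close>, while \<open>p\<close> divides \<open>j!\<close> exactly once.\<close>

lemma prime_dvd_central_binomial':
  assumes p: "prime p" and j: "j < 2 * p" "3 * p \<le> 2 * j"
  shows "p dvd ((2 * j) choose j)"
proof -
  have p0: "p > 0" using p by (simp add: prime_gt_0_nat)
  define u where "u = \<Prod>({1..p - 1} \<union> {Suc p..j})"
  have "fact j = \<Prod>{1..j}" by (simp add: fact_prod)
  also have "{1..j} = insert p ({1..p - 1} \<union> {Suc p..j})" using p0 j by auto
  finally have fj: "fact j = p * u" unfolding u_def by (subst (asm) prod.insert) (use p0 in auto)
  have "\<not> p dvd k" if "k \<in> {1..p - 1} \<union> {Suc p..j}" for k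
  proof
    assume "p dvd k"
    then obtain q where q: "k = p * q" by (rule dvdE)
    from that p0 j have "p * 0 < k" "k < p * 2" "k \<noteq> p * 1" by auto
    with q p0 have "0 < q" "q < 2" "q \<noteq> 1" by (auto simp del: mult_0_right)
    then show False by simp
  qed
  then have u: "\<not> p dvd u"
    using p unfolding u_def by (subst prime_dvd_prod_iff) auto
  have f2j: "fact j * fact j * ((2 * j) choose j) = (fact (2 * j) :: nat)"
    using binomial_fact_lemma[of j "2 * j"] by simp
  have "fact p dvd (fact p :: nat)" "p dvd fact p" using p by (simp_all add: prime_dvd_fact_iff)
  then have "p * (p * p) dvd fact p * (fact p * fact p)" by (intro mult_dvd_mono)
  also have "\<dots> dvd fact p * fact (p + p)" by (intro mult_dvd_mono fact_fact_dvd_fact dvd_refl)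
  also have "\<dots> dvd fact (p + (p + p))" by (rule fact_fact_dvd_fact)
  also have "\<dots> dvd fact (2 * j)" using j by (intro fact_dvd) simp
  also have "fact (2 * j) = p * (p * (u * u * ((2 * j) choose j)))"
    unfolding f2j[symmetric] fj by (simp add: ac_simps)
  finally have "p dvd u * u * ((2 * j) choose j)" using p0 by simp
  then show ?thesis using p u by (simp add: prime_dvd_mult_iff)
qed

lemma prime_dvd_quartic_coeff:
  assumes "prime p" "k < p" "p < 4 * k"
  shows "p dvd quartic_coeff k"
proof (cases "p \<le> 2 * k")
  case True
  then show ?thesis using prime_dvd_central_binomial[of p k] assms by (simp add: quartic_coeff_def)
next
  case False
  then show ?thesis using prime_dvd_central_binomial[of p "2 * k"] assms by (simp add: quartic_coeff_def)
qed

lemma prime_square_dvd_quartic_coeff: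
  assumes "prime p" "k < p" "3 * p \<le> 4 * k"
  shows "p\<^sup>2 dvd quartic_coeff k"
  unfolding quartic_coeff_def power2_eq_square
  using assms prime_dvd_central_binomial[of p k] prime_dvd_central_binomial'[of p "2 * k"]
  by (intro mult_dvd_mono) simp_all

text \<open>As polynomials in \<open>v\<close>, both sides have the same coefficients below degree \<open>p\<close> by Clausen's identity,
and from degree \<open>p\<close> on every single term is divisible by \<open>p\<^sup>2\<close>.\<close>

lemma clausen_truncated:
  fixes v :: int
  assumes p: "prime p" "p > 2"
  shows "[(\<Sum>k<p. int (quartic_coeff k) * v ^ k)\<^sup>2 =
          (\<Sum>k<p. int (((2 * k) choose k) * quartic_coeff k) * (v * (1 - 64 * v)) ^ k)] (mod int (p\<^sup>2))"
proof -
  define f :: "int poly" where "f = (\<Sum>k<p. monom (int (quartic_coeff k)) k)"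
  define g :: "int poly" where "g = (\<Sum>k<p. smult (int (((2 * k) choose k) * quartic_coeff k)) (quad_poly ^ k))"
  have cf: "coeff f i = (if i < p then int (quartic_coeff i) else 0)" for i
    by (simp add: f_def coeff_sum)
  have c4: "\<not> p = 4 * k" for k using p by (metis dvd_triv_left even_mult_iff even_numeral prime_odd_nat)
  have "[coeff (f\<^sup>2) m = coeff g m] (mod int (p\<^sup>2))" for m
  proof (cases "m < p")
    case True
    have "coeff (f\<^sup>2) m = (\<Sum>i\<le>m. int (quartic_coeff i) * int (quartic_coeff (m - i)))"
      unfolding power2_eq_square coeff_mult using True by (intro sum.cong) (auto simp: cf)
    also have "\<dots> = (\<Sum>i\<le>m. int (((2 * i) choose i) * quartic_coeff i) * coeff (quad_poly ^ i) m)"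
      by (rule clausen_coeff)
    also have "\<dots> = (\<Sum>i<p. int (((2 * i) choose i) * quartic_coeff i) * coeff (quad_poly ^ i) m)"
      by (rule sum.mono_neutral_left) (use True in \<open>auto simp: quad_poly_power_coeff_low\<close>)
    also have "\<dots> = coeff g m" by (simp add: g_def coeff_sum)
    finally show ?thesis by simp
  next
    case False
    have "int (p\<^sup>2) dvd coeff (f\<^sup>2) m"
      unfolding power2_eq_square[of f] coeff_mult
    proof (intro dvd_sum)
      fix i assume i: "i \<in> {..m}"
      show "int (p\<^sup>2) dvd coeff f i * coeff f (m - i)"
      proof (cases "i < p \<and> m - i < p")
        case True
        have "p\<^sup>2 dvd quartic_coeff i * quartic_coeff (m - i)"
        proof -
          \<comment> \<open>if one index is below \<open>p / 4\<close>, the other exceeds \<open>3 p / 4\<close> since they add up to \<open>m \<ge> p\<close>\<close>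
          consider "p < 4 * i" "p < 4 * (m - i)" | "3 * p \<le> 4 * (m - i)" | "3 * p \<le> 4 * i"
            using c4[of i] c4[of "m - i"] i False by fastforce
          then show ?thesis
          proof cases
            case 1
            then show ?thesis using True p unfolding power2_eq_square
              by (intro mult_dvd_mono prime_dvd_quartic_coeff) auto
          next
            case 2
            then show ?thesis using True p by (intro dvd_mult prime_square_dvd_quartic_coeff) auto
          next
            case 3
            then show ?thesis using True p by (intro dvd_mult2 prime_square_dvd_quartic_coeff) auto
          qed
        qed
        then show ?thesis using True by (simp only: cf if_True int_dvd_int_iff flip: of_nat_mult)
      qed (auto simp: cf)
    qed
    moreover have "int (p\<^sup>2) dvd coeff g m"
      unfolding g_def coeff_sum
    proof (intro dvd_sum)
      fix i assume i: "i \<in> {..<p}"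
      show "int (p\<^sup>2) dvd coeff (smult (int (((2 * i) choose i) * quartic_coeff i)) (quad_poly ^ i)) m"
      proof (cases "2 * i < m")
        case True
        then show ?thesis by (simp add: quad_poly_power_coeff_high)
      next
        case n: False
        then have "p dvd ((2 * i) choose i)"
          using i False p by (intro prime_dvd_central_binomial) auto
        moreover from this have "p dvd quartic_coeff i" by (simp add: quartic_coeff_def)
        ultimately have "p\<^sup>2 dvd ((2 * i) choose i) * quartic_coeff i"
          unfolding power2_eq_square by (rule mult_dvd_mono)
        then show ?thesis by (simp only: coeff_smult int_dvd_int_iff dvd_mult2)
      qed
    qed
    ultimately show ?thesis by (metis cong_0_iff cong_sym cong_trans)
  qed
  then have dvd: "int (p\<^sup>2) dvd coeff (f\<^sup>2 - g) m" for m by (simp add: cong_iff_dvd_diff)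
  have "int (p\<^sup>2) dvd poly (f\<^sup>2 - g) v"
    unfolding poly_altdef by (intro dvd_sum dvd_mult2 dvd)
  then have "[(poly f v)\<^sup>2 = poly g v] (mod int (p\<^sup>2))"
    by (simp add: cong_iff_dvd_diff)
  moreover have "poly f v = (\<Sum>k<p. int (quartic_coeff k) * v ^ k)"
    by (simp add: f_def poly_sum poly_monom)
  moreover have "poly g v = (\<Sum>k<p. int (((2 * k) choose k) * quartic_coeff k) * (v * (1 - 64 * v)) ^ k)"
    by (simp add: g_def poly_sum quad_poly_def algebra_simps)
  ultimately show ?thesis by (simp only:)
qed

section \<open>Legendre polynomials and binomial coefficients modulo p\<close>

lemma binomial_fact_prod: "int (n choose k) * fact k = (\<Prod>i<k. int n - int i)"
proof -
  have "(of_int (int (n choose k) * fact k) :: rat) = of_int (\<Prod>i<k. int n - int i)"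
    using gbinomial_mult_fact'[of "of_nat n :: rat" k]
    by (simp add: binomial_gbinomial atLeast0LessThan)
  then show ?thesis by (simp only: of_int_eq_iff)
qed

lemma binomial_fact_prod_rising: "int ((n + k) choose k) * fact k = (\<Prod>i<k. int n + 1 + int i)"
proof -
  have "(\<Prod>i<k. int (n + k) - int i) = (\<Prod>i<k. int (n + k) - int (k - Suc i))"
    by (rule prod.nat_diff_reindex[symmetric])
  also have "\<dots> = (\<Prod>i<k. int n + 1 + int i)"
    by (intro prod.cong) (auto simp: of_nat_diff)
  finally show ?thesis by (simp add: binomial_fact_prod)
qed

lemma binomial_pair_prod:
  "int ((n choose k) * ((n + k) choose k)) * (fact k)\<^sup>2 = (\<Prod>i<k. (int n - int i) * (int n + 1 + int i))"
  unfolding prod.distrib binomial_fact_prod[symmetric] binomial_fact_prod_rising[symmetric]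
  by (simp add: power2_eq_square)

lemma prod_const_mult: "(\<Prod>i<k. c * f i) = (c :: int) ^ k * (\<Prod>i<(k::nat). f i)"
  by (simp add: prod.distrib)

text \<open>The numbers \<open>(3 k)! / (k!) ^ 3\<close>.\<close>

definition cubic_coeff :: "nat \<Rightarrow> nat" where
  "cubic_coeff k = ((2 * k) choose k) * ((3 * k) choose k)"

lemma quartic_coeff_prod:
  "int (quartic_coeff k) * (fact k)\<^sup>2 = 4 ^ k * (\<Prod>i<k. (4 * int i + 1) * (4 * int i + 3))"
proof (induction k)
  case (Suc k)
  have "int (quartic_coeff (Suc k)) * (fact (Suc k))\<^sup>2 =
      ((int k + 1)\<^sup>2 * int (quartic_coeff (Suc k))) * (fact k)\<^sup>2"
    by (simp add: power2_eq_square algebra_simps)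
  also have "\<dots> = 4 * (4 * int k + 1) * (4 * int k + 3) * (int (quartic_coeff k) * (fact k)\<^sup>2)"
    unfolding quartic_coeff_Suc by simp
  finally show ?case unfolding Suc.IH by simp
qed (simp add: quartic_coeff_def)

lemma central_binomial_prod: "int ((2 * k) choose k) * fact k = 2 ^ k * (\<Prod>i<k. 2 * int i + 1)"
proof (induction k)
  case (Suc k)
  have "int ((2 * Suc k) choose Suc k) * fact (Suc k) =
      ((int k + 1) * int ((2 * Suc k) choose Suc k)) * fact k"
    by (simp del: mult_Suc_right)
  also have "\<dots> = 2 * (2 * int k + 1) * (int ((2 * k) choose k) * fact k)"
    unfolding central_binomial_Suc by simp
  finally show ?case unfolding Suc.IH by simp
qed simp

lemma cubic_coeff_prod':
  "int (cubic_coeff k) * (fact k)\<^sup>2 = 2 ^ k * (\<Prod>i<k. 2 * int i + 1) * (\<Prod>i<k. 2 * int k + 1 + int i)"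
proof -
  have "int ((3 * k) choose k) * fact k = (\<Prod>i<k. 2 * int k + 1 + int i)"
    using binomial_fact_prod_rising[of "2 * k" k] by simp
  then show ?thesis
    unfolding cubic_coeff_def central_binomial_prod[symmetric]
    by (simp add: power2_eq_square flip: \<open>int ((3 * k) choose k) * fact k = _\<close>)
qed

lemma cubic_coeff_fact: "int (cubic_coeff k) * fact k ^ 3 = fact (3 * k)"
proof -
  have 2: "fact (2 * k) = fact k * fact k * ((2 * k) choose k)"
    using binomial_fact_lemma[of k "2 * k"] by simp
  have "fact (3 * k) = fact k * fact (2 * k) * ((3 * k) choose k)"
    using binomial_fact_lemma[of k "3 * k"] by simp
  then have "cubic_coeff k * fact k ^ 3 = fact (3 * k)"
    unfolding 2 cubic_coeff_def by (simp add: power3_eq_cube)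
  from arg_cong[OF this, of int] show ?thesis by simp
qed

lemma cubic_coeff_prod:
  "int (cubic_coeff k) * (fact k)\<^sup>2 = 3 ^ k * (\<Prod>i<k. (3 * int i + 1) * (3 * int i + 2))"
proof -
  have "fact (3 * k) = fact k * (3 ^ k * (\<Prod>i<k. (3 * int i + 1) * (3 * int i + 2)))"
  proof (induction k)
    case (Suc k)
    have "fact (3 * Suc k) = (3 * int k + 3) * (3 * int k + 2) * (3 * int k + 1) * fact (3 * k)"
      by (simp add: eval_nat_numeral algebra_simps)
    then show ?case unfolding Suc.IH by (simp add: algebra_simps)
  qed simp
  then have "fact k * (int (cubic_coeff k) * (fact k)\<^sup>2) =
      fact k * (3 ^ k * (\<Prod>i<k. (3 * int i + 1) * (3 * int i + 2)))"
    by (simp add: cubic_coeff_fact[symmetric] power2_eq_square power3_eq_cube)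
  then show ?thesis by simp
qed

text \<open>Both expressions are \<open>1 / 2 ^ n\<close> times the coefficient of \<open>X ^ n\<close> in \<open>((t + X)\<^sup>2 - 1) ^ n\<close>, the second
one by factoring \<open>(t + X)\<^sup>2 - 1 = Z * (Z + 2)\<close> with \<open>Z = t - 1 + X\<close>.\<close>

lemma legendre_poly_shifted:
  fixes t :: "'a::field_char_0"
  shows "poly (legendre_poly n) t =
    (\<Sum>k\<le>n. of_nat ((n choose k) * ((n + k) choose k)) * ((t - 1) / 2) ^ k)"
proof -
  let ?A = "[:t, 1:]" and ?Z = "[:t - 1, 1:]"
  have "coeff ((?A\<^sup>2 - 1) ^ n) n =
      (\<Sum>k\<le>n div 2. of_nat (n choose k) * (- 1) ^ k * of_nat ((2 * n - 2 * k) choose n) * t ^ (n - 2 * k))"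
  proof -
    have "(?A\<^sup>2 - 1) ^ n = (- 1 + ?A\<^sup>2) ^ n" by simp
    also have "\<dots> = (\<Sum>k\<le>n. of_nat (n choose k) * (- 1) ^ k * (?A\<^sup>2) ^ (n - k))"
      by (rule binomial_ring)
    also have "\<dots> = (\<Sum>k\<le>n. smult (of_nat (n choose k) * (- 1) ^ k) (?A ^ (2 * (n - k))))"
    proof (intro sum.cong refl)
      fix k
      have "of_nat (n choose k) * (- 1) ^ k = [:of_nat (n choose k) * (- 1) ^ k :: 'a:]"
        by (cases "even k") (simp_all add: of_nat_poly)
      then show "of_nat (n choose k) * (- 1) ^ k * (?A\<^sup>2) ^ (n - k) =
          smult (of_nat (n choose k) * (- 1) ^ k) (?A ^ (2 * (n - k)))"
        by (simp add: power_mult)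
    qed
    finally have "coeff ((?A\<^sup>2 - 1) ^ n) n =
        (\<Sum>k\<le>n. of_nat (n choose k) * (- 1) ^ k * coeff (?A ^ (2 * (n - k))) n)"
      by (simp add: coeff_sum)
    also have "\<dots> = (\<Sum>k\<le>n div 2. of_nat (n choose k) * (- 1) ^ k * coeff (?A ^ (2 * (n - k))) n)"
    proof (rule sum.mono_neutral_right)
      show "\<forall>k\<in>{..n} - {..n div 2}. of_nat (n choose k) * (- 1) ^ k * coeff (?A ^ (2 * (n - k))) n = 0"
      proof
        fix k assume "k \<in> {..n} - {..n div 2}"
        then have "degree (?A ^ (2 * (n - k))) < n" by (simp add: degree_power_eq) linarith
        then show "of_nat (n choose k) * (- 1) ^ k * coeff (?A ^ (2 * (n - k))) n = 0"
          by (simp add: coeff_eq_0)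
      qed
    qed auto
    also have "\<dots> = (\<Sum>k\<le>n div 2. of_nat (n choose k) * (- 1) ^ k * of_nat ((2 * n - 2 * k) choose n) * t ^ (n - 2 * k))"
    proof (intro sum.cong refl)
      fix k assume "k \<in> {..n div 2}"
      then have "n \<le> 2 * (n - k)" "2 * (n - k) - n = n - 2 * k" "2 * (n - k) = 2 * n - 2 * k" by auto
      then show "of_nat (n choose k) * (- 1) ^ k * coeff (?A ^ (2 * (n - k))) n =
          of_nat (n choose k) * (- 1) ^ k * of_nat ((2 * n - 2 * k) choose n) * t ^ (n - 2 * k)"
        by (simp add: coeff_linear_poly_power)
    qed
    finally show ?thesis .
  qed
  then have 1: "poly (legendre_poly n) t = coeff ((?A\<^sup>2 - 1) ^ n) n / 2 ^ n"
    by (simp add: legendre_poly_def poly_sum poly_monom)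
  have "?A\<^sup>2 - 1 = ?Z * ([:2:] + ?Z)"
    by (simp add: power2_eq_square algebra_simps one_pCons)
  then have "(?A\<^sup>2 - 1) ^ n = ?Z ^ n * ([:2:] + ?Z) ^ n"
    by (simp only: power_mult_distrib)
  also have "\<dots> = ?Z ^ n * (?Z + [:2:]) ^ n" by (simp only: add.commute)
  also have "\<dots> = (\<Sum>k\<le>n. ?Z ^ n * (of_nat (n choose k) * ?Z ^ k * [:2:] ^ (n - k)))"
    unfolding binomial_ring by (rule sum_distrib_left)
  also have "\<dots> = (\<Sum>k\<le>n. smult (of_nat (n choose k) * 2 ^ (n - k)) (?Z ^ (n + k)))"
  proof (intro sum.cong refl)
    fix k
    have "of_nat (n choose k) * [:2:] ^ (n - k) = [:of_nat (n choose k) * 2 ^ (n - k) :: 'a:]"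
      by (simp add: of_nat_poly poly_const_pow)
    moreover have "?Z ^ n * (of_nat (n choose k) * ?Z ^ k * [:2:] ^ (n - k)) =
        (of_nat (n choose k) * [:2:] ^ (n - k)) * ?Z ^ (n + k)"
      unfolding power_add by (simp only: ac_simps)
    ultimately show "?Z ^ n * (of_nat (n choose k) * ?Z ^ k * [:2:] ^ (n - k)) =
        smult (of_nat (n choose k) * 2 ^ (n - k)) (?Z ^ (n + k))" by (simp only: mult_pCons_left) simp
  qed
  finally have "coeff ((?A\<^sup>2 - 1) ^ n) n =
      (\<Sum>k\<le>n. of_nat (n choose k) * 2 ^ (n - k) * coeff (?Z ^ (n + k)) n)"
    by (simp add: coeff_sum)
  then have "poly (legendre_poly n) t =
      (\<Sum>k\<le>n. of_nat (n choose k) * 2 ^ (n - k) * coeff (?Z ^ (n + k)) n / 2 ^ n)"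
    unfolding 1 by (simp add: sum_divide_distrib)
  also have "\<dots> = (\<Sum>k\<le>n. of_nat ((n choose k) * ((n + k) choose k)) * ((t - 1) / 2) ^ k)"
  proof (intro sum.cong refl)
    fix k assume "k \<in> {..n}"
    then have k: "k \<le> n" by simp
    have "coeff (?Z ^ (n + k)) n = of_nat ((n + k) choose k) * (t - 1) ^ k"
      using coeff_linear_poly_power[of n "n + k" "t - 1" 1] binomial_symmetric[of n "n + k"] by simp
    moreover have "(2::'a) ^ n = 2 ^ (n - k) * 2 ^ k" using k by (simp flip: power_add)
    ultimately show "of_nat (n choose k) * 2 ^ (n - k) * coeff (?Z ^ (n + k)) n / 2 ^ n =
        of_nat ((n choose k) * ((n + k) choose k)) * ((t - 1) / 2) ^ k"
      by (simp add: power_divide)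
  qed
  finally show ?thesis .
qed

lemma legendre_poly_minus:
  "poly (legendre_poly n) (- t) = (- 1) ^ n * poly (legendre_poly n) (t :: 'a::field_char_0)"
proof -
  have "(- t) ^ (n - 2 * k) = (- 1) ^ n * t ^ (n - 2 * k)" if "k \<le> n div 2" for k
  proof -
    have "even (n - 2 * k) \<longleftrightarrow> even n" using that by presburger
    then show ?thesis by (simp add: power_minus[of t] minus_one_power_iff)
  qed
  then show ?thesis
    by (simp add: legendre_poly_def poly_sum poly_monom sum_distrib_left)
      (intro sum.cong refl, simp)
qed

text \<open>The integer values of the Legendre polynomial at \<open>1 - 2 z\<close>; its parity becomes the symmetry
\<open>z \<mapsto> 1 - z\<close>.\<close>

definition shifted_legendre :: "nat \<Rightarrow> int \<Rightarrow> int" where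
  "shifted_legendre n z = (\<Sum>k\<le>n. int ((n choose k) * ((n + k) choose k)) * (- z) ^ k)"

lemma of_int_shifted_legendre:
  "(of_int (shifted_legendre n z) :: rat) = poly (legendre_poly n) (1 - 2 * of_int z)"
  by (simp add: shifted_legendre_def legendre_poly_shifted)

lemma shifted_legendre_reflect: "shifted_legendre n (1 - z) = (- 1) ^ n * shifted_legendre n z"
proof -
  have "(of_int (shifted_legendre n (1 - z)) :: rat) = of_int ((- 1) ^ n * shifted_legendre n z)"
    using legendre_poly_minus[of n "1 - 2 * of_int z :: rat"]
    by (simp add: of_int_shifted_legendre algebra_simps)
  then show ?thesis by (simp only: of_int_eq_iff)
qed

lemma shifted_legendre_cong:
  "[y = z] (mod m) \<Longrightarrow> [shifted_legendre n y = shifted_legendre n z] (mod m)"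
  unfolding shifted_legendre_def
  by (intro cong_sum cong_mult cong_refl cong_pow) (simp add: cong_minus_minus_iff)

context odd_prime
begin

lemma cancel_fact:
  assumes "k < p" "[a * (fact k)\<^sup>2 = b * (fact k)\<^sup>2] (mod int p)"
  shows "[a = b] (mod int p)"
proof -
  have "\<not> p dvd fact k" using assms(1) prime_p by (simp add: prime_dvd_fact_iff)
  then have "\<not> int p dvd fact k" by (metis int_dvd_int_iff of_nat_fact)
  then have "\<not> int p dvd (fact k)\<^sup>2" using prime_int by (simp add: prime_dvd_power_iff)
  from mult_cancel_cong[OF this, of a b] show ?thesis
    using assms(2) by (simp only: mult.commute)
qed

definition half :: nat where "half = (p - 1) div 2"

lemma two_half_nat: "2 * half + 1 = p"
  unfolding half_def using odd_p p_gt_2 by presburger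

lemma two_half: "2 * int half = int p - 1"
  using two_half_nat by linarith

text \<open>In the next four lemmas the products behind the binomial coefficients are compared factor by factor
after replacing \<open>(p - 1) div 2\<close>, \<open>p div 4\<close> or \<open>p div 3\<close> by the rational number to which it is congruent.\<close>

lemma binomial_half_cong:
  assumes "k < p"
  shows "[16 ^ k * int ((half choose k) * ((half - k) choose k)) = int (quartic_coeff k)] (mod int p)"
proof (rule cancel_fact[OF assms])
  have e: "(half choose k) * ((half - k) choose k) = (half choose (2 * k)) * ((2 * k) choose k)"
  proof (cases "2 * k \<le> half")
    case True
    then show ?thesis using choose_mult[of k "2 * k" half] by simp
  qed (auto simp: binomial_eq_0)
  have fk: "int ((2 * k) choose k) * (fact k)\<^sup>2 = fact (2 * k)"
    using arg_cong[OF binomial_fact_lemma[of k "2 * k"], of int] by (simp add: power2_eq_square ac_simps)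
  have "16 ^ k * int ((half choose k) * ((half - k) choose k)) * (fact k)\<^sup>2 =
      16 ^ k * (int (half choose (2 * k)) * fact (2 * k))"
    unfolding e fk[symmetric] by simp
  also have "\<dots> = 4 ^ k * (\<Prod>i<2 * k. 2 * (int half - int i))"
  proof -
    have "(16 :: int) ^ k = 4 ^ k * 2 ^ (2 * k)" by (simp add: power_mult flip: power_mult_distrib)
    then show ?thesis by (simp only: binomial_fact_prod prod_const_mult mult.assoc)
  qed
  also have "[\<dots> = 4 ^ k * (\<Prod>i<2 * k. - (2 * int i + 1))] (mod int p)"
  proof (intro cong_mult cong_refl cong_prod)
    fix i
    have "2 * (int half - int i) - (- (2 * int i + 1)) = int p"
      using two_half by simp
    then show "[2 * (int half - int i) = - (2 * int i + 1)] (mod int p)"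
      by (simp only: cong_iff_dvd_diff dvd_refl)
  qed
  also have "(\<Prod>i<2 * k. - (2 * int i + 1)) = (\<Prod>i<k. (4 * int i + 1) * (4 * int i + 3))"
    by (induction k) (simp_all add: algebra_simps)
  also have "4 ^ k * (\<Prod>i<k. (4 * int i + 1) * (4 * int i + 3)) = int (quartic_coeff k) * (fact k)\<^sup>2"
    by (rule quartic_coeff_prod[symmetric])
  finally show "[16 ^ k * int ((half choose k) * ((half - k) choose k)) * (fact k)\<^sup>2 =
      int (quartic_coeff k) * (fact k)\<^sup>2] (mod int p)" .
qed

lemma binomial_quarter_cong:
  assumes "k < p"
  shows "[64 ^ k * int ((p div 4 choose k) * ((p div 4 + k) choose k)) =
          (- 1) ^ k * int (quartic_coeff k)] (mod int p)"
proof (rule cancel_fact[OF assms])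
  let ?n = "p div 4"
  have "64 ^ k * int ((?n choose k) * ((?n + k) choose k)) * (fact k)\<^sup>2 =
      64 ^ k * (\<Prod>i<k. (int ?n - int i) * (int ?n + 1 + int i))"
    unfolding binomial_pair_prod[symmetric] by simp
  also have "\<dots> = 4 ^ k * (\<Prod>i<k. (4 * int ?n - 4 * int i) * (4 * int ?n + 4 + 4 * int i))"
  proof -
    have "(\<Prod>i<k. (4 * int ?n - 4 * int i) * (4 * int ?n + 4 + 4 * int i)) =
        (\<Prod>i<k. 16 * ((int ?n - int i) * (int ?n + 1 + int i)))"
      by (intro prod.cong refl) (simp add: algebra_simps)
    also have "\<dots> = 16 ^ k * (\<Prod>i<k. (int ?n - int i) * (int ?n + 1 + int i))"
      by (rule prod_const_mult)
    finally show ?thesis by (simp flip: power_mult_distrib)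
  qed
  also have "[\<dots> = 4 ^ k * (\<Prod>i<k. - 1 * ((4 * int i + 1) * (4 * int i + 3)))] (mod int p)"
  proof (rule cong_mult[OF cong_refl cong_prod])
    fix i
    have "p mod 4 = 1 \<or> p mod 4 = 3" using odd_p by presburger
    then have "4 * int ?n = int p - 1 \<or> 4 * int ?n = int p - 3" by presburger
    then show "[(4 * int ?n - 4 * int i) * (4 * int ?n + 4 + 4 * int i) =
        - 1 * ((4 * int i + 1) * (4 * int i + 3))] (mod int p)"
    proof
      assume e: "4 * int ?n = int p - 1"
      have "(4 * int ?n - 4 * int i) * (4 * int ?n + 4 + 4 * int i) - (- 1 * ((4 * int i + 1) * (4 * int i + 3)))
          = int p * (int p + 2)"
        unfolding e by (simp add: algebra_simps)
      then show ?thesis by (simp only: cong_iff_dvd_diff dvd_triv_left)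
    next
      assume e: "4 * int ?n = int p - 3"
      have "(4 * int ?n - 4 * int i) * (4 * int ?n + 4 + 4 * int i) - (- 1 * ((4 * int i + 1) * (4 * int i + 3)))
          = int p * (int p - 2)"
        unfolding e by (simp add: algebra_simps)
      then show ?thesis by (simp only: cong_iff_dvd_diff dvd_triv_left)
    qed
  qed
  also have "4 ^ k * (\<Prod>i<k. - 1 * ((4 * int i + 1) * (4 * int i + 3))) =
      (- 1) ^ k * (4 ^ k * (\<Prod>i<k. (4 * int i + 1) * (4 * int i + 3)))"
    by (simp only: prod_const_mult mult.left_commute)
  also have "\<dots> = (- 1) ^ k * int (quartic_coeff k) * (fact k)\<^sup>2"
    unfolding quartic_coeff_prod[symmetric] by simp
  finally show "[64 ^ k * int ((?n choose k) * ((?n + k) choose k)) * (fact k)\<^sup>2 =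
      (- 1) ^ k * int (quartic_coeff k) * (fact k)\<^sup>2] (mod int p)" .
qed

lemma binomial_third_cong:
  assumes "k < p" "p \<noteq> 3"
  shows "[27 ^ k * int ((p div 3 choose k) * ((p div 3 + k) choose k)) =
          (- 1) ^ k * int (cubic_coeff k)] (mod int p)"
proof (rule cancel_fact[OF assms(1)])
  let ?n = "p div 3"
  have "27 ^ k * int ((?n choose k) * ((?n + k) choose k)) * (fact k)\<^sup>2 =
      27 ^ k * (\<Prod>i<k. (int ?n - int i) * (int ?n + 1 + int i))"
    unfolding binomial_pair_prod[symmetric] by simp
  also have "\<dots> = 3 ^ k * (\<Prod>i<k. (3 * int ?n - 3 * int i) * (3 * int ?n + 3 + 3 * int i))"
  proof -
    have "(\<Prod>i<k. (3 * int ?n - 3 * int i) * (3 * int ?n + 3 + 3 * int i)) =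
        (\<Prod>i<k. 9 * ((int ?n - int i) * (int ?n + 1 + int i)))"
      by (intro prod.cong refl) (simp add: algebra_simps)
    also have "\<dots> = 9 ^ k * (\<Prod>i<k. (int ?n - int i) * (int ?n + 1 + int i))"
      by (rule prod_const_mult)
    finally show ?thesis by (simp flip: power_mult_distrib)
  qed
  also have "[\<dots> = 3 ^ k * (\<Prod>i<k. - 1 * ((3 * int i + 1) * (3 * int i + 2)))] (mod int p)"
  proof (rule cong_mult[OF cong_refl cong_prod])
    fix i
    have "\<not> 3 dvd p" using assms(2) prime_p by (metis One_nat_def numeral_eq_one_iff semiring_norm(86) prime_nat_iff)
    then have "p mod 3 = 1 \<or> p mod 3 = 2" by presburger
    then have "3 * int ?n = int p - 1 \<or> 3 * int ?n = int p - 2" by presburger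
    then show "[(3 * int ?n - 3 * int i) * (3 * int ?n + 3 + 3 * int i) =
        - 1 * ((3 * int i + 1) * (3 * int i + 2))] (mod int p)"
    proof
      assume e: "3 * int ?n = int p - 1"
      have "(3 * int ?n - 3 * int i) * (3 * int ?n + 3 + 3 * int i) - (- 1 * ((3 * int i + 1) * (3 * int i + 2)))
          = int p * (int p + 1)"
        unfolding e by (simp add: algebra_simps)
      then show ?thesis by (simp only: cong_iff_dvd_diff dvd_triv_left)
    next
      assume e: "3 * int ?n = int p - 2"
      have "(3 * int ?n - 3 * int i) * (3 * int ?n + 3 + 3 * int i) - (- 1 * ((3 * int i + 1) * (3 * int i + 2)))
          = int p * (int p - 1)"
        unfolding e by (simp add: algebra_simps)
      then show ?thesis by (simp only: cong_iff_dvd_diff dvd_triv_left)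
    qed
  qed
  also have "3 ^ k * (\<Prod>i<k. - 1 * ((3 * int i + 1) * (3 * int i + 2))) =
      (- 1) ^ k * (3 ^ k * (\<Prod>i<k. (3 * int i + 1) * (3 * int i + 2)))"
    by (simp only: prod_const_mult mult.left_commute)
  also have "\<dots> = (- 1) ^ k * int (cubic_coeff k) * (fact k)\<^sup>2"
    unfolding cubic_coeff_prod[symmetric] by simp
  finally show "[27 ^ k * int ((?n choose k) * ((?n + k) choose k)) * (fact k)\<^sup>2 =
      (- 1) ^ k * int (cubic_coeff k) * (fact k)\<^sup>2] (mod int p)" .
qed

lemma binomial_half_cubic_cong:
  assumes "k \<le> half"
  shows "[4 ^ k * int ((half choose k) * ((2 * half - 2 * k) choose k)) = int (cubic_coeff k)] (mod int p)"
proof (rule cancel_fact)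
  show "k < p" using assms two_half_nat by linarith
  have "4 ^ k * int ((half choose k) * ((2 * half - 2 * k) choose k)) * (fact k)\<^sup>2 =
      2 ^ k * (2 ^ k * (int (half choose k) * fact k)) * (int ((2 * half - 2 * k) choose k) * fact k)"
    by (simp add: power2_eq_square flip: power_mult_distrib)
  also have "\<dots> = 2 ^ k * (\<Prod>i<k. 2 * (int half - int i)) * (\<Prod>i<k. int (2 * half - 2 * k) - int i)"
    by (simp only: binomial_fact_prod prod_const_mult)
  also have "[\<dots> = 2 ^ k * (\<Prod>i<k. - 1 * (2 * int i + 1)) * (\<Prod>i<k. - 1 * (2 * int k + 1 + int i))] (mod int p)"
  proof (rule cong_mult[OF cong_mult[OF cong_refl cong_prod] cong_prod])
    fix i
    have "2 * (int half - int i) - (- 1 * (2 * int i + 1)) = int p"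
      using two_half by simp
    then show "[2 * (int half - int i) = - 1 * (2 * int i + 1)] (mod int p)"
      by (simp only: cong_iff_dvd_diff dvd_refl)
    have "int (2 * half - 2 * k) - int i - (- 1 * (2 * int k + 1 + int i)) = int p"
      using two_half assms by (simp add: of_nat_diff)
    then show "[int (2 * half - 2 * k) - int i = - 1 * (2 * int k + 1 + int i)] (mod int p)"
      by (simp only: cong_iff_dvd_diff dvd_refl)
  qed
  also have "2 ^ k * (\<Prod>i<k. - 1 * (2 * int i + 1)) * (\<Prod>i<k. - 1 * (2 * int k + 1 + int i)) =
      int (cubic_coeff k) * (fact k)\<^sup>2"
    unfolding cubic_coeff_prod' prod_const_mult by (simp flip: power_mult_distrib)
  finally show "[4 ^ k * int ((half choose k) * ((2 * half - 2 * k) choose k)) * (fact k)\<^sup>2 =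
      int (cubic_coeff k) * (fact k)\<^sup>2] (mod int p)" .
qed

end

section \<open>Two families of elliptic curves modulo p\<close>

context odd_prime
begin

lemma one_le_half: "1 \<le> half"
  using two_half_nat p_gt_2 by linarith

lemma sum_extend_to_prime:
  assumes "n < p" "\<And>k. n < k \<Longrightarrow> f k = (0::int)"
  shows "(\<Sum>k\<le>n. f k) = (\<Sum>k<p. f k)"
  by (rule sum.mono_neutral_left) (use assms in auto)

text \<open>The Legendre symbol sum for \<open>y\<^sup>2 = x\<^sup>3 + x\<^sup>2 + 16 v x\<close>, read modulo \<open>p\<close>.\<close>

lemma quartic_curve_sum:
  "[(\<Sum>x\<in>residues_mod. (x ^ 3 + x\<^sup>2 + 16 * v * x) ^ half) =
    - (\<Sum>k<p. int (quartic_coeff k) * v ^ k)] (mod int p)"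
proof -
  let ?X = "monom 1 1 :: int poly" and ?b = "16 * v"
  define F where "F = [:0, ?b, 1, 1:] ^ half"
  have deg: "degree F < 2 * (p - 1)"
    using two_half_nat one_le_half by (simp add: F_def degree_power_eq)
  have pF: "poly F x = (x ^ 3 + x\<^sup>2 + 16 * v * x) ^ half" for x
    by (simp add: F_def algebra_simps power2_eq_square power3_eq_cube)
  have p1: "p - 1 = half + half" using two_half_nat by linarith
  have "[:0, ?b, 1, 1:] = ?X * ([:?b:] + ?X * [:1, 1:])"
    by (simp add: monom_altdef)
  then have "F = monom 1 half * ([:?b:] + ?X * [:1, 1:]) ^ half"
    unfolding F_def by (simp only: power_mult_distrib monom_power) simp
  then have "coeff F (p - 1) = coeff (([:?b:] + ?X * [:1, 1:]) ^ half) half"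
    unfolding p1 by (simp add: coeff_monom_mult)
  also have "\<dots> = (\<Sum>k\<le>half. coeff (of_nat (half choose k) * [:?b:] ^ k * (?X * [:1, 1:]) ^ (half - k)) half)"
    unfolding binomial_ring coeff_sum ..
  also have "\<dots> = (\<Sum>k\<le>half. int ((half choose k) * ((half - k) choose k)) * ?b ^ k)"
  proof (intro sum.cong refl)
    fix k assume "k \<in> {..half}"
    then have k: "k \<le> half" by simp
    have c: "of_nat (half choose k) * [:?b:] ^ k = [:int (half choose k) * ?b ^ k:]"
      by (simp add: of_nat_poly poly_const_pow)
    have "coeff ([:1, 1:] ^ (half - k)) k = int ((half - k) choose k)"
    proof (cases "k \<le> half - k")
      case True
      then show ?thesis using coeff_linear_poly_power[OF True, of 1 1] by simp
    next
      case False
      then show ?thesis by (simp add: coeff_eq_0 degree_power_eq binomial_eq_0)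
    qed
    moreover have "(?X * [:1, 1:]) ^ (half - k) = monom 1 (half - k) * [:1, 1:] ^ (half - k)"
      by (simp only: power_mult_distrib monom_power) simp
    ultimately have "coeff ((?X * [:1, 1:]) ^ (half - k)) half = int ((half - k) choose k)"
      using k by (simp only: coeff_monom_mult) auto
    then show "coeff (of_nat (half choose k) * [:?b:] ^ k * (?X * [:1, 1:]) ^ (half - k)) half =
        int ((half choose k) * ((half - k) choose k)) * ?b ^ k"
      unfolding c by (simp only: mult_pCons_left) simp
  qed
  also have "\<dots> = (\<Sum>k<p. int ((half choose k) * ((half - k) choose k)) * ?b ^ k)"
    using two_half_nat by (intro sum_extend_to_prime) (auto simp: binomial_eq_0)
  also have "[\<dots> = (\<Sum>k<p. int (quartic_coeff k) * v ^ k)] (mod int p)"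
  proof (rule cong_sum)
    fix k assume "k \<in> {..<p}"
    then have "[16 ^ k * int ((half choose k) * ((half - k) choose k)) * v ^ k = int (quartic_coeff k) * v ^ k] (mod int p)"
      by (intro cong_mult cong_refl binomial_half_cong) simp
    then show "[int ((half choose k) * ((half - k) choose k)) * ?b ^ k = int (quartic_coeff k) * v ^ k] (mod int p)"
      by (simp only: power_mult_distrib ac_simps)
  qed
  finally have "[- coeff F (p - 1) = - (\<Sum>k<p. int (quartic_coeff k) * v ^ k)] (mod int p)"
    by (simp only: cong_minus_minus_iff)
  then show ?thesis
    using cong_trans[OF sum_poly_mod[OF deg]] by (simp only: pF)
qed

text \<open>The same for \<open>y\<^sup>2 = x\<^sup>3 + d (x + 4 d r)\<^sup>2\<close>, a curve on which \<open>x = 0\<close> belongs to a subgroup of order three.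
The scaling \<open>4 d r\<close> makes the result depend on \<open>d\<close> only through its quadratic character.\<close>

lemma cubic_curve_sum:
  assumes "p \<noteq> 3"
  shows "[(\<Sum>x\<in>residues_mod. (x ^ 3 + d * (x + 4 * d * r)\<^sup>2) ^ half) =
    - (d ^ half * shifted_legendre (p div 3) (27 * r))] (mod int p)"
proof -
  let ?b = "4 * d * r" and ?n = "p div 3"
  define F where "F = (monom 1 3 + [:d:] * [:?b, 1:]\<^sup>2) ^ half"
  have deg: "degree F < 2 * (p - 1)"
  proof -
    have "degree ([:d:] * [:?b, 1:]\<^sup>2) \<le> 2"
      using degree_mult_le[of "[:d:]" "[:?b, 1:]\<^sup>2"] by (simp add: degree_power_eq)
    then have "degree (monom 1 3 + [:d:] * [:?b, 1:]\<^sup>2) \<le> 3"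
      by (intro degree_add_le) (auto simp: degree_monom_eq)
    then have "degree F \<le> 3 * half"
      unfolding F_def using degree_power_le[of "monom 1 3 + [:d:] * [:?b, 1:]\<^sup>2" half]
      by (meson le_trans mult_le_mono1)
    then show ?thesis using two_half_nat one_le_half by linarith
  qed
  have pF: "poly F x = (x ^ 3 + d * (x + 4 * d * r)\<^sup>2) ^ half" for x
    by (simp add: F_def poly_monom add.commute)
  have p1: "p - 1 = 2 * half" using two_half_nat by linarith
  have "coeff F (p - 1) = (\<Sum>k\<le>half. coeff (of_nat (half choose k) * monom 1 3 ^ k * ([:d:] * [:?b, 1:]\<^sup>2) ^ (half - k)) (2 * half))"
    unfolding p1 F_def binomial_ring coeff_sum ..
  also have "\<dots> = (\<Sum>k\<le>half. int ((half choose k) * ((2 * half - 2 * k) choose k)) * d ^ (half - k) * ?b ^ k)"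
  proof (intro sum.cong refl)
    fix k assume "k \<in> {..half}"
    then have k: "k \<le> half" by simp
    have "of_nat (half choose k) * monom 1 3 ^ k * ([:d:] * [:?b, 1:]\<^sup>2) ^ (half - k) =
        (of_nat (half choose k) * [:d:] ^ (half - k)) * (monom 1 3 ^ k * ([:?b, 1:]\<^sup>2) ^ (half - k))"
      by (simp only: power_mult_distrib ac_simps)
    also have "of_nat (half choose k) * [:d:] ^ (half - k) = [:int (half choose k) * d ^ (half - k):]"
      by (simp add: of_nat_poly poly_const_pow)
    also have "monom (1::int) 3 ^ k * ([:?b, 1:]\<^sup>2) ^ (half - k) = monom 1 (3 * k) * [:?b, 1:] ^ (2 * half - 2 * k)"
      by (simp add: monom_power diff_mult_distrib2 flip: power_mult)
    finally have "coeff (of_nat (half choose k) * monom 1 3 ^ k * ([:d:] * [:?b, 1:]\<^sup>2) ^ (half - k)) (2 * half) =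
        int (half choose k) * d ^ (half - k) * coeff (monom 1 (3 * k) * [:?b, 1:] ^ (2 * half - 2 * k)) (2 * half)"
      by (simp only: mult_pCons_left) simp
    also have "coeff (monom 1 (3 * k) * [:?b, 1:] ^ (2 * half - 2 * k)) (2 * half) =
        int ((2 * half - 2 * k) choose k) * ?b ^ k"
    proof (cases "3 * k \<le> 2 * half")
      case True
      have "coeff ([:?b, 1:] ^ (2 * half - 2 * k)) (2 * half - 3 * k) =
          int ((2 * half - 2 * k) choose (2 * half - 3 * k)) * ?b ^ (2 * half - 2 * k - (2 * half - 3 * k))"
        by (subst coeff_linear_poly_power) auto
      also have "2 * half - 2 * k - (2 * half - 3 * k) = k" using True by linarith
      also have "(2 * half - 2 * k) choose (2 * half - 3 * k) = (2 * half - 2 * k) choose k"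
      proof -
        have "2 * half - 2 * k - k = 2 * half - 3 * k" "k \<le> 2 * half - 2 * k" using True by linarith+
        then show ?thesis by (metis binomial_symmetric)
      qed
      finally show ?thesis using True by (simp only: coeff_monom_mult) simp
    next
      case False
      then have "(2 * half - 2 * k) choose k = 0" by (intro binomial_eq_0) linarith
      then show ?thesis using False by (simp only: coeff_monom_mult) simp
    qed
    finally show "coeff (of_nat (half choose k) * monom 1 3 ^ k * ([:d:] * [:?b, 1:]\<^sup>2) ^ (half - k)) (2 * half) =
        int ((half choose k) * ((2 * half - 2 * k) choose k)) * d ^ (half - k) * ?b ^ k"
      by simp
  qed
  also have "\<dots> = (\<Sum>k\<le>half. d ^ half * r ^ k * (4 ^ k * int ((half choose k) * ((2 * half - 2 * k) choose k))))"
  proof (intro sum.cong refl)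
    fix k assume "k \<in> {..half}"
    then have "d ^ half = d ^ (half - k) * d ^ k" by (simp flip: power_add)
    then show "int ((half choose k) * ((2 * half - 2 * k) choose k)) * d ^ (half - k) * ?b ^ k =
        d ^ half * r ^ k * (4 ^ k * int ((half choose k) * ((2 * half - 2 * k) choose k)))"
      by (simp only: power_mult_distrib ac_simps)
  qed
  also have "[\<dots> = (\<Sum>k\<le>half. d ^ half * r ^ k * int (cubic_coeff k))] (mod int p)"
    by (intro cong_sum cong_scalar_left binomial_half_cubic_cong) simp
  finally have 1: "[coeff F (p - 1) = (\<Sum>k\<le>half. d ^ half * r ^ k * int (cubic_coeff k))] (mod int p)" .
  have 2: "[(\<Sum>k\<le>half. d ^ half * r ^ k * int (cubic_coeff k)) =
      (\<Sum>k\<le>half. d ^ half * r ^ k * ((- 1) ^ k * (27 ^ k * int ((?n choose k) * ((?n + k) choose k)))))] (mod int p)"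
  proof (intro cong_sum cong_scalar_left)
    fix k assume "k \<in> {..half}"
    then have "k < p" using two_half_nat by simp
    from cong_scalar_left[OF binomial_third_cong[OF this assms], of "(- 1) ^ k"]
    have "[(- 1) ^ k * (27 ^ k * int ((?n choose k) * ((?n + k) choose k))) =
        ((- 1) ^ k * (- 1) ^ k) * int (cubic_coeff k)] (mod int p)"
      by (simp only: mult.assoc)
    also have "(- 1 :: int) ^ k * (- 1) ^ k = 1" by (simp flip: power_mult_distrib)
    finally show "[int (cubic_coeff k) = (- 1) ^ k * (27 ^ k * int ((?n choose k) * ((?n + k) choose k)))] (mod int p)"
      by (simp add: cong_sym_eq)
  qed
  have "(\<Sum>k\<le>half. d ^ half * r ^ k * ((- 1) ^ k * (27 ^ k * int ((?n choose k) * ((?n + k) choose k))))) =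
      d ^ half * (\<Sum>k\<le>half. int ((?n choose k) * ((?n + k) choose k)) * (- (27 * r)) ^ k)"
    unfolding sum_distrib_left
  proof (intro sum.cong refl)
    fix k
    have "(- (27 * r)) ^ k = (- 1) ^ k * 27 ^ k * r ^ k"
      by (simp add: power_minus[of "27 * r"] power_mult_distrib)
    then show "d ^ half * r ^ k * ((- 1) ^ k * (27 ^ k * int ((?n choose k) * ((?n + k) choose k)))) =
        d ^ half * (int ((?n choose k) * ((?n + k) choose k)) * (- (27 * r)) ^ k)"
      by (simp only: ac_simps)
  qed
  also have "(\<Sum>k\<le>half. int ((?n choose k) * ((?n + k) choose k)) * (- (27 * r)) ^ k) =
      shifted_legendre ?n (27 * r)"
    unfolding shifted_legendre_def
    by (rule sum.mono_neutral_right) (use p1 in \<open>auto simp: binomial_eq_0\<close>)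
  finally have "[coeff F (p - 1) = d ^ half * shifted_legendre ?n (27 * r)] (mod int p)"
    using cong_trans[OF 1 2] by simp
  then have "[- coeff F (p - 1) = - (d ^ half * shifted_legendre ?n (27 * r))] (mod int p)"
    by (simp only: cong_minus_minus_iff)
  then show ?thesis
    using cong_trans[OF sum_poly_mod[OF deg]] by (simp only: pF)
qed

lemma legendre_poly_quartic_cong:
  assumes "[u = - 64 * v] (mod int p)"
  shows "[(\<Sum>k\<le>p div 4. int ((p div 4 choose k) * ((p div 4 + k) choose k)) * u ^ k) =
          (\<Sum>k<p. int (quartic_coeff k) * v ^ k)] (mod int p)"
proof -
  let ?n = "p div 4"
  have "(\<Sum>k\<le>?n. int ((?n choose k) * ((?n + k) choose k)) * u ^ k) =
      (\<Sum>k<p. int ((?n choose k) * ((?n + k) choose k)) * u ^ k)"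
    using p_gt_2 by (intro sum_extend_to_prime) (auto simp: binomial_eq_0)
  also have "[\<dots> = (\<Sum>k<p. int (quartic_coeff k) * v ^ k)] (mod int p)"
  proof (rule cong_sum)
    fix k assume "k \<in> {..<p}"
    then have k: "k < p" by simp
    have "[int ((?n choose k) * ((?n + k) choose k)) * u ^ k =
        int ((?n choose k) * ((?n + k) choose k)) * (- 64 * v) ^ k] (mod int p)"
      by (intro cong_mult cong_refl cong_pow assms)
    also have "(- 64 * v) ^ k = (- 1) ^ k * 64 ^ k * v ^ k"
      by (simp add: power_minus[of "64 * v"] power_mult_distrib)
    also have "int ((?n choose k) * ((?n + k) choose k)) * ((- 1) ^ k * 64 ^ k * v ^ k) =
        (- 1) ^ k * v ^ k * (64 ^ k * int ((?n choose k) * ((?n + k) choose k)))"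
      by (simp only: ac_simps)
    also have "[\<dots> = (- 1) ^ k * v ^ k * ((- 1) ^ k * int (quartic_coeff k))] (mod int p)"
      by (intro cong_scalar_left binomial_quarter_cong k)
    also have "(- 1) ^ k * v ^ k * ((- 1) ^ k * int (quartic_coeff k)) =
        ((- 1) ^ k * (- 1) ^ k) * (int (quartic_coeff k) * v ^ k)"
      by (simp only: ac_simps)
    also have "(- 1 :: int) ^ k * (- 1) ^ k = 1" by (simp flip: power_mult_distrib)
    finally show "[int ((?n choose k) * ((?n + k) choose k)) * u ^ k = int (quartic_coeff k) * v ^ k] (mod int p)"
      by simp
  qed
  finally show ?thesis .
qed

end

section \<open>The 3-isogeny at a square root of 3\<close>

context odd_prime
begin

lemma not_dvd_smooth: "p \<noteq> 3 \<Longrightarrow> \<not> int p dvd 2 ^ a * 3 ^ b"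
proof
  assume p3: "p \<noteq> 3" and "int p dvd 2 ^ a * 3 ^ b"
  then have "int p dvd 2 \<or> int p dvd 3"
    using prime_int prime_dvd_mult_iff prime_dvd_power by blast
  then have "int p \<le> 3" using zdvd_imp_le[of "int p" 2] zdvd_imp_le[of "int p" 3] by auto
  then show False using p3 p_gt_2 by simp
qed

lemma solve_linear_mod:
  assumes "\<not> int p dvd n"
  obtains z where "[n * z = c] (mod int p)"
proof -
  obtain b where "[n * b = 1] (mod int p)" using inverse_mod_exists assms by metis
  then have "[n * b * c = 1 * c] (mod int p)" by (rule cong_scalar_right)
  then show ?thesis using that[of "b * c"] by (simp add: mult.assoc)
qed

text \<open>The curve \<open>y\<^sup>2 = x\<^sup>3 + x\<^sup>2 + 16 v x\<close> and the curve \<open>y\<^sup>2 = x\<^sup>3 - (2 s - 3) x\<close> are 3-isogenous up to a quadratic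
twist. Shifting \<open>x\<close> to a kernel abscissa (\<open>x0\<close> and \<open>1\<close>, respectively) brings both to the form
\<open>y\<^sup>2 = x\<^sup>3 + d (x + 4 d r)\<^sup>2\<close>, with parameters \<open>(d, r)\<close> and \<open>(3, r')\<close> such that \<open>27 r + 27 r' = 1\<close> modulo \<open>p\<close>. The
symmetry of \<open>shifted_legendre\<close> then compares the two sums; \<open>q\<close> is its value at \<open>27 r'\<close>.\<close>

lemma isogenous_models:
  assumes p3: "p \<noteq> 3" and s: "[s\<^sup>2 = 3] (mod int p)" and v: "[1536 * v = 12 - 7 * s] (mod int p)"
  obtains d q where
    "[8 * d = 3 * (1 + s)] (mod int p)"
    "[(\<Sum>k<p. int (quartic_coeff k) * v ^ k) = (- 1) ^ (p div 3) * d ^ half * q] (mod int p)"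
    "[(\<Sum>x\<in>residues_mod. (x ^ 3 - (2 * s - 3) * x) ^ half) = - (3 ^ half * q)] (mod int p)"
proof -
  obtain d where d: "[8 * d = 3 * (1 + s)] (mod int p)"
    using solve_linear_mod[of 8 "3 * (1 + s)"] not_dvd_smooth[OF p3, of 3 0] by auto
  obtain x0 where x0: "[3 * x0 = d - 1] (mod int p)"
    using solve_linear_mod[of 3 "d - 1"] not_dvd_smooth[OF p3, of 0 1] by auto
  obtain r where r: "[108 * r = 3 * s - 5] (mod int p)"
    using solve_linear_mod[of 108 "3 * s - 5"] not_dvd_smooth[OF p3, of 2 3] by auto
  obtain r' where r': "[36 * r' = 3 - s] (mod int p)"
    using solve_linear_mod[of 36 "3 - s"] not_dvd_smooth[OF p3, of 2 2] by auto
  have cancel: "int p dvd y" if "int p dvd 2 ^ a * 3 ^ b * y" for a b and y :: int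
    using that not_dvd_smooth[OF p3, of a b] prime_int prime_dvd_mult_iff by blast
  \<comment> \<open>\<open>G1\<close> to \<open>G5\<close> generate the ideal of relations; \<open>G6\<close> to \<open>G8\<close> are shown to lie in it by
    writing a multiple of each, by powers of 2 and 3, as an explicit combination\<close>
  define G1 where "G1 = s\<^sup>2 - 3"
  define G2 where "G2 = 8 * d - 3 * (1 + s)"
  define G3 where "G3 = 3 * x0 - (d - 1)"
  define G4 where "G4 = 108 * r - (3 * s - 5)"
  define G5 where "G5 = 1536 * v - (12 - 7 * s)"
  have G: "int p dvd G1" "int p dvd G2" "int p dvd G3" "int p dvd G4" "int p dvd G5"
    using s d x0 r v by (simp_all add: G1_def G2_def G3_def G4_def G5_def cong_iff_dvd_diff)
  define G6 where "G6 = 32 * d\<^sup>2 - 9 * (2 + s)"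
  have "2 ^ 1 * 3 ^ 0 * G6 = G2 * (8 * d + 3 + 3 * s) + 9 * G1"
    by (simp add: G6_def G2_def G1_def algebra_simps power2_eq_square)
  also have "int p dvd \<dots>" using G by (intro dvd_add dvd_mult dvd_mult2)
  finally have G6: "int p dvd G6" by (rule cancel)
  define G7 where "G7 = 3 * x0\<^sup>2 + 2 * x0 + 16 * v - 8 * d\<^sup>2 * r"
  have "2 ^ 5 * 3 ^ 1 * G7 =
      32 * (3 * x0 + 1 + d) * G3 + (1 - 24 * r) * G6 + 1 * G5 - 2 * (2 + s) * G4 - 6 * G1"
    by (simp add: G7_def G6_def G5_def G4_def G3_def G1_def algebra_simps power2_eq_square)
  also have "int p dvd \<dots>" using G G6 by (intro dvd_add dvd_diff dvd_mult)
  finally have G7: "int p dvd G7" by (rule cancel)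
  define G8 where "G8 = x0 ^ 3 + x0\<^sup>2 + 16 * v * x0 - 16 * d ^ 3 * r\<^sup>2"
  have "2 ^ 8 * 3 ^ 3 * G8 =
      256 * (9 * x0\<^sup>2 + 3 * x0 * (d - 1) + (d - 1)\<^sup>2 + 3 * (3 * x0 + d - 1) + 144 * v) * G3
      + 8 * d * (1 - 432 * r\<^sup>2) * G6 + 24 * (d - 1) * G5
      + (- 42 - 12 * s - 3888 * r\<^sup>2 * (2 + s)) * G2 - 36 * G1
      - 11664 * r\<^sup>2 * G1 - (5 + 3 * s) * (108 * r + 3 * s - 5) * G4 - 9 * (3 * s - 5) * G1"
    unfolding G8_def G6_def G5_def G4_def G3_def G2_def G1_def
    by (simp add: algebra_simps power2_eq_square power3_eq_cube)
  also have "int p dvd \<dots>" using G G6 by (intro dvd_add dvd_diff dvd_mult)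
  finally have G8: "int p dvd G8" by (rule cancel)
  have model1: "[((x + x0) ^ 3 + (x + x0)\<^sup>2 + 16 * v * (x + x0)) = x ^ 3 + d * (x + 4 * d * r)\<^sup>2] (mod int p)" for x
  proof -
    have "((x + x0) ^ 3 + (x + x0)\<^sup>2 + 16 * v * (x + x0)) - (x ^ 3 + d * (x + 4 * d * r)\<^sup>2) =
        x\<^sup>2 * G3 + x * G7 + G8"
      by (simp add: G8_def G7_def G3_def algebra_simps power2_eq_square power3_eq_cube)
    then show ?thesis using G(3) G7 G8 by (simp only: cong_iff_dvd_diff dvd_add dvd_mult)
  qed
  have model2: "[((x + 1) ^ 3 - (2 * s - 3) * (x + 1)) = x ^ 3 + 3 * (x + 4 * 3 * r')\<^sup>2] (mod int p)" for x
  proof -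
    define H where "H = 36 * r' - (3 - s)"
    have H: "int p dvd H" using r' by (simp add: H_def cong_iff_dvd_diff)
    have "2 ^ 0 * 3 ^ 1 * (((x + 1) ^ 3 - (2 * s - 3) * (x + 1)) - (x ^ 3 + 3 * (x + 4 * 3 * r')\<^sup>2)) =
        - (6 * x + 36 * r' + 3 - s) * H - 1 * G1"
      by (simp add: H_def G1_def algebra_simps power2_eq_square power3_eq_cube)
    also have "int p dvd \<dots>" using G H by (intro dvd_diff dvd_mult)
    finally show ?thesis unfolding cong_iff_dvd_diff by (rule cancel)
  qed
  let ?q = "shifted_legendre (p div 3) (27 * r')"
  have shift: "[(\<Sum>x\<in>residues_mod. f x ^ half) = (\<Sum>x\<in>residues_mod. f (x + c) ^ half)] (mod int p)"
    if "\<And>x. [f (x mod int p) = f x] (mod int p)" for f :: "int \<Rightarrow> int" and c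
    by (rule cong_sym, rule cong_sum_residues_reindex[where f = "\<lambda>x. f x ^ half"])
      (auto intro!: cong_pow that simp: cong_add_rcancel)
  have "[- (\<Sum>k<p. int (quartic_coeff k) * v ^ k) = (\<Sum>x\<in>residues_mod. (x ^ 3 + x\<^sup>2 + 16 * v * x) ^ half)] (mod int p)"
    by (rule cong_sym[OF quartic_curve_sum])
  also have "[(\<Sum>x\<in>residues_mod. (x ^ 3 + x\<^sup>2 + 16 * v * x) ^ half) =
      (\<Sum>x\<in>residues_mod. ((x + x0) ^ 3 + (x + x0)\<^sup>2 + 16 * v * (x + x0)) ^ half)] (mod int p)"
    by (rule shift) (intro cong_add cong_mult cong_pow cong_refl, auto simp: cong_def)
  also have "[(\<Sum>x\<in>residues_mod. ((x + x0) ^ 3 + (x + x0)\<^sup>2 + 16 * v * (x + x0)) ^ half) =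
      (\<Sum>x\<in>residues_mod. (x ^ 3 + d * (x + 4 * d * r)\<^sup>2) ^ half)] (mod int p)"
    by (intro cong_sum cong_pow model1)
  also have "[(\<Sum>x\<in>residues_mod. (x ^ 3 + d * (x + 4 * d * r)\<^sup>2) ^ half) =
      - (d ^ half * shifted_legendre (p div 3) (27 * r))] (mod int p)"
    by (rule cubic_curve_sum[OF p3])
  finally have 1: "[(\<Sum>k<p. int (quartic_coeff k) * v ^ k) = d ^ half * shifted_legendre (p div 3) (27 * r)] (mod int p)"
    by (simp only: cong_minus_minus_iff)
  have "[27 * r = 1 - 27 * r'] (mod int p)"
  proof -
    have "2 ^ 2 * 3 ^ 0 * (27 * r - (1 - 27 * r')) = 1 * G4 + 3 * (36 * r' - (3 - s))"
      by (simp add: G4_def)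
    also have "int p dvd \<dots>" using G r' unfolding cong_iff_dvd_diff by (intro dvd_add dvd_mult)
    finally show ?thesis unfolding cong_iff_dvd_diff by (rule cancel)
  qed
  then have "[shifted_legendre (p div 3) (27 * r) = (- 1) ^ (p div 3) * ?q] (mod int p)"
    unfolding shifted_legendre_reflect[symmetric] by (rule shifted_legendre_cong)
  then have "[d ^ half * shifted_legendre (p div 3) (27 * r) = d ^ half * ((- 1) ^ (p div 3) * ?q)] (mod int p)"
    by (rule cong_scalar_left)
  from cong_trans[OF 1 this]
  have 2: "[(\<Sum>k<p. int (quartic_coeff k) * v ^ k) = (- 1) ^ (p div 3) * d ^ half * ?q] (mod int p)"
    by (simp only: ac_simps)
  have "[(\<Sum>x\<in>residues_mod. (x ^ 3 - (2 * s - 3) * x) ^ half) =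
      (\<Sum>x\<in>residues_mod. ((x + 1) ^ 3 - (2 * s - 3) * (x + 1)) ^ half)] (mod int p)"
    by (rule shift) (intro cong_diff cong_mult cong_pow cong_refl, auto simp: cong_def)
  also have "[(\<Sum>x\<in>residues_mod. ((x + 1) ^ 3 - (2 * s - 3) * (x + 1)) ^ half) =
      (\<Sum>x\<in>residues_mod. (x ^ 3 + 3 * (x + 4 * 3 * r')\<^sup>2) ^ half)] (mod int p)"
    by (intro cong_sum cong_pow model2)
  also have "[(\<Sum>x\<in>residues_mod. (x ^ 3 + 3 * (x + 4 * 3 * r')\<^sup>2) ^ half) = - (3 ^ half * ?q)] (mod int p)"
    by (rule cubic_curve_sum[OF p3])
  finally have 3: "[(\<Sum>x\<in>residues_mod. (x ^ 3 - (2 * s - 3) * x) ^ half) = - (3 ^ half * ?q)] (mod int p)" .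
  show ?thesis by (rule that[OF d 2 3])
qed

text \<open>For odd \<open>(p - 1) div 2\<close> the sum for \<open>y\<^sup>2 = x\<^sup>3 - k x\<close> changes sign under \<open>x \<mapsto> - x\<close>.\<close>

lemma quartic_sum_supersingular:
  assumes p: "p mod 12 = 11" and s: "[s\<^sup>2 = 3] (mod int p)" and v: "[1536 * v = 12 - 7 * s] (mod int p)"
  shows "[(\<Sum>k<p. int (quartic_coeff k) * v ^ k) = 0] (mod int p)"
proof -
  have p3: "p \<noteq> 3" using p by auto
  obtain d q where "[8 * d = 3 * (1 + s)] (mod int p)"
    and dq: "[(\<Sum>k<p. int (quartic_coeff k) * v ^ k) = (- 1) ^ (p div 3) * d ^ half * q] (mod int p)"
    "[(\<Sum>x\<in>residues_mod. (x ^ 3 - (2 * s - 3) * x) ^ half) = - (3 ^ half * q)] (mod int p)"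
    by (rule isogenous_models[OF p3 s v])
  have odd: "odd half" using p two_half_nat by presburger
  let ?f = "\<lambda>x. (x ^ 3 - (2 * s - 3) * x) ^ half"
  have "[(\<Sum>x\<in>residues_mod. ?f (- 1 * x)) = (\<Sum>x\<in>residues_mod. ?f x)] (mod int p)"
  proof (rule cong_sum_residues_reindex)
    fix x y :: int
    show "[?f (x mod int p) = ?f x] (mod int p)"
      by (intro cong_pow cong_diff cong_mult cong_refl) (auto simp: cong_def)
    assume "[- 1 * x = - 1 * y] (mod int p)"
    then show "[x = y] (mod int p)" by (simp add: cong_minus_minus_iff)
  qed
  moreover have "?f (- 1 * x) = - ?f x" for x
  proof -
    have "(- 1 * x) ^ 3 - (2 * s - 3) * (- 1 * x) = - (x ^ 3 - (2 * s - 3) * x)"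
      by (simp add: power3_eq_cube algebra_simps)
    then show ?thesis using odd by (metis power_minus_odd)
  qed
  ultimately have "[- (\<Sum>x\<in>residues_mod. ?f x) = (\<Sum>x\<in>residues_mod. ?f x)] (mod int p)"
    by (simp only: sum_negf)
  then have "int p dvd - (2 * (\<Sum>x\<in>residues_mod. ?f x))" by (simp add: cong_iff_dvd_diff)
  then have "int p dvd (\<Sum>x\<in>residues_mod. ?f x)"
    using not_dvd_2 prime_int by (simp add: prime_dvd_mult_iff)
  then have "int p dvd 3 ^ half * q" using dq(2) by (metis cong_dvd_iff dvd_minus_iff)
  then have "int p dvd q"
    using not_dvd_smooth[OF p3, of 0 half] prime_int by (simp add: prime_dvd_mult_iff)
  then show ?thesis using dq(1) by (metis cong_0_iff cong_trans dvd_mult)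
qed

text \<open>For \<open>p\<close> congruent to 1 modulo 12, the Jacobsthal sum \<open>J\<close> at \<open>2 s - 3\<close> satisfies \<open>J\<^sup>2 + K\<^sup>2 = 4 p\<close> and is
congruent to 1 modulo 3 by the rotation argument. So \<open>K / 2\<close> is divisible by 3, and uniqueness of the
representation \<open>p = x\<^sup>2 + 9 y\<^sup>2\<close> gives \<open>- J = 2 x\<close> including the sign.\<close>

lemma quartic_sum_ordinary:
  assumes p: "p mod 12 = 1" and s: "[s\<^sup>2 = 3] (mod int p)" and v: "[1536 * v = 12 - 7 * s] (mod int p)"
    and xy: "int p = x\<^sup>2 + 9 * y\<^sup>2" and x: "3 dvd x - 1"
  shows "[(\<Sum>k<p. int (quartic_coeff k) * v ^ k) = chi (2 + 2 * s) * (2 * x)] (mod int p)"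
proof -
  have p3: "p \<noteq> 3" using p by auto
  note smooth = not_dvd_smooth[OF p3]
  have n2: "\<not> int p dvd 2" and n3: "\<not> int p dvd 3" using smooth[of 1 0] smooth[of 0 1] by simp_all
  obtain d q where d: "[8 * d = 3 * (1 + s)] (mod int p)"
    and dq: "[(\<Sum>k<p. int (quartic_coeff k) * v ^ k) = (- 1) ^ (p div 3) * d ^ half * q] (mod int p)"
    "[(\<Sum>x\<in>residues_mod. (x ^ 3 - (2 * s - 3) * x) ^ half) = - (3 ^ half * q)] (mod int p)"
    by (rule isogenous_models[OF p3 s v])
  have "even (p div 3)" using p by presburger
  then have m1: "(- 1 :: int) ^ (p div 3) = 1" by simp
  have ns: "\<not> int p dvd s"
  proof
    assume "int p dvd s"
    then have "int p dvd s\<^sup>2" by (simp add: power2_eq_square)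
    with s n3 show False by (metis cong_dvd_iff)
  qed
  have chi3: "chi 3 = 1" using chi_cong[OF s] chi_square[OF ns] by simp
  have chi_euler': "[a ^ half = chi a] (mod int p)" for a
    using chi_euler[of a] by (simp add: half_def cong_sym_eq)
  have chid: "chi d = chi (2 + 2 * s)"
  proof -
    have "[8 * (8 * d) = 8 * (3 * (1 + s))] (mod int p)" by (rule cong_scalar_left[OF d])
    then have "[8\<^sup>2 * d = 3 * 2\<^sup>2 * (2 + 2 * s)] (mod int p)" by (simp add: algebra_simps)
    then have "chi (8\<^sup>2 * d) = chi (3 * 2\<^sup>2 * (2 + 2 * s))" by (rule chi_cong)
    then show ?thesis
      using chi_square[OF n2] chi_square[of 8] smooth[of 3 0] chi3 by (simp only: chi_mult) simp
  qed
  define J where "J = jacobsthal (2 * s - 3)"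
  have "[(\<Sum>x\<in>residues_mod. (x ^ 3 - (2 * s - 3) * x) ^ half) = J] (mod int p)"
    unfolding J_def jacobsthal_def by (intro cong_sum chi_euler')
  then have "[J = - (3 ^ half * q)] (mod int p)" using dq(2) by (metis cong_sym cong_trans)
  also have "[- (3 ^ half * q) = - (chi 3 * q)] (mod int p)"
    unfolding cong_minus_minus_iff by (intro cong_scalar_right chi_euler')
  finally have "[- J = - (- (chi 3 * q))] (mod int p)" by (simp only: cong_minus_minus_iff)
  then have Jq: "[- J = q] (mod int p)" by (simp add: chi3)
  have "[(\<Sum>k<p. int (quartic_coeff k) * v ^ k) = chi d * (- J)] (mod int p)"
  proof -
    have "[d ^ half * q = chi d * (- J)] (mod int p)"
      by (intro cong_mult chi_euler' cong_sym[OF Jq])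
    with dq(1) show ?thesis unfolding m1 mult_1_left by (rule cong_trans)
  qed
  moreover have "- J = 2 * x"
  proof -
    have J3: "3 dvd J - 1"
    proof -
      \<comment> \<open>as \<open>s\<^sup>2 = 3\<close>, shifting \<open>x\<close> by 1 turns \<open>x ^ 3 - (2 s - 3) x\<close> into \<open>x ^ 3 + (s x + s - 1)\<^sup>2\<close>\<close>
      let ?b = "s - 1"
      have nb: "\<not> int p dvd ?b"
      proof
        assume "int p dvd ?b"
        then have "int p dvd ?b * (s + 1)" by simp
        moreover have "[?b * (s + 1) = 2] (mod int p)"
        proof -
          have e: "?b * (s + 1) - 2 = s\<^sup>2 - 3" by (simp add: algebra_simps power2_eq_square)
          show ?thesis using s unfolding cong_iff_dvd_diff e .
        qed
        ultimately show False using n2 by (metis cong_dvd_iff)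
      qed
      have flex: "\<not> [c ^ 3 = 2 * ?b] (mod int p)" if c: "[3 * c = 2 * s] (mod int p)" for c
      proof
        assume c3: "[c ^ 3 = 2 * ?b] (mod int p)"
        define A where "A = s\<^sup>2 - 3"
        define B where "B = 3 * c - 2 * s"
        define C where "C = c ^ 3 - 2 * ?b"
        have AB: "int p dvd A" "int p dvd B" "int p dvd C"
          using s c c3 by (simp_all add: A_def B_def C_def cong_iff_dvd_diff)
        \<comment> \<open>\<open>27 c ^ 3 = 8 s ^ 3\<close> gives \<open>5 s = 9\<close>, and then \<open>75 = 25 s\<^sup>2 = 81\<close>\<close>
        have "6 * (5 * s - 9) = (9 * c\<^sup>2 + 6 * c * s + 4 * s\<^sup>2) * B + 8 * s * A - 27 * C"
          by (simp add: A_def B_def C_def algebra_simps power2_eq_square power3_eq_cube)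
        also have "int p dvd \<dots>" using AB by (intro dvd_add dvd_diff dvd_mult)
        finally have "int p dvd 6 * (5 * s - 9)" .
        with prime_dvd_mult_iff[OF prime_int, of 6 "5 * s - 9"] smooth[of 1 1] have "int p dvd 5 * s - 9"
          by (simp only:) simp
        from dvd_diff[OF dvd_mult[OF this] dvd_mult[OF AB(1)]]
        have "int p dvd (5 * s + 9) * (5 * s - 9) - 25 * A" .
        also have "(5 * s + 9) * (5 * s - 9) - 25 * A = - 6"
          by (simp add: A_def algebra_simps power2_eq_square)
        finally show False using smooth[of 1 1] by simp
      qed
      have "J = (\<Sum>x\<in>residues_mod. chi ((x + 1) ^ 3 - (2 * s - 3) * (x + 1)))"
        unfolding J_def jacobsthal_def
        by (rule sum_residues_shift[where f = "\<lambda>x. chi (x ^ 3 - (2 * s - 3) * x)", symmetric])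
          (intro chi_cong cong_diff cong_mult cong_pow cong_refl, auto simp: cong_def)
      also have "\<dots> = (\<Sum>x\<in>residues_mod. chi (x ^ 3 + (s * x + ?b)\<^sup>2))"
      proof (intro sum.cong refl chi_cong)
        fix x
        have "(x ^ 3 + (s * x + ?b)\<^sup>2) - ((x + 1) ^ 3 - (2 * s - 3) * (x + 1)) = (x + 1)\<^sup>2 * (s\<^sup>2 - 3)"
          by (simp add: algebra_simps power2_eq_square power3_eq_cube)
        then show "[(x + 1) ^ 3 - (2 * s - 3) * (x + 1) = x ^ 3 + (s * x + ?b)\<^sup>2] (mod int p)"
          using s by (metis cong_iff_dvd_diff cong_sym dvd_mult)
      qed
      finally have "3 dvd int p - 2 + J" using cubic_sum_mod_3[OF nb flex] by simp
      moreover have "3 dvd int p - 1" using p by presburger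
      ultimately show ?thesis by presburger
    qed
    obtain g where g: "chi g = - 1" using nonresidue_exists .
    have chim1: "chi (- 1) = 1"
    proof (rule chi_eqI)
      have "even half" using p two_half_nat by presburger
      then have "(- 1 :: int) ^ half = 1" by simp
      then show "[chi (- 1) = 1] (mod int p)" using chi_euler'[of "- 1"] by (simp add: cong_sym_eq)
    qed simp
    have nk: "\<not> int p dvd 2 * s - 3"
    proof
      assume "int p dvd 2 * s - 3"
      from dvd_diff[OF dvd_mult[OF this] dvd_mult[OF s[unfolded cong_iff_dvd_diff]]]
      have "int p dvd (2 * s + 3) * (2 * s - 3) - 4 * (s\<^sup>2 - 3)" .
      also have "(2 * s + 3) * (2 * s - 3) - 4 * (s\<^sup>2 - 3) = 3"
        by (simp add: algebra_simps power2_eq_square)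
      finally show False using n3 by simp
    qed
    define K where "K = jacobsthal (g * (2 * s - 3))"
    have JK: "J\<^sup>2 + K\<^sup>2 = 4 * int p"
      unfolding J_def K_def by (rule jacobsthal_identity[OF chim1 nk g])
    have "4 dvd J\<^sup>2 + K\<^sup>2" unfolding JK by simp
    have evenJ: "even J" and evenK: "even K"
    proof -
      have sq: "z\<^sup>2 mod 4 = (if even z then 0 else 1)" for z :: int
      proof (cases "even z")
        case True
        then obtain w where "z = 2 * w" by (rule evenE)
        then show ?thesis by (simp add: power2_eq_square)
      next
        case False
        then obtain w where "z = 2 * w + 1" by (rule oddE)
        then have "z\<^sup>2 = 4 * (w\<^sup>2 + w) + 1" by (simp add: power2_eq_square algebra_simps)
        then show ?thesis using False by (simp only: if_False) presburger
      qed
      have "(J\<^sup>2 mod 4 + K\<^sup>2 mod 4) mod 4 = 0" using \<open>4 dvd J\<^sup>2 + K\<^sup>2\<close> by (simp add: mod_add_eq)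
      then show "even J" "even K" unfolding sq by (auto split: if_splits)
    qed
    define X where "X = - (J div 2)"
    define Z where "Z = K div 2"
    have JX: "J = - 2 * X" and KZ: "K = 2 * Z" using evenJ evenK by (auto simp: X_def Z_def)
    have pXZ: "int p = X\<^sup>2 + Z\<^sup>2" using JK unfolding JX KZ by (simp add: power2_eq_square)
    have X1: "3 dvd X - 1" using J3 unfolding JX by presburger
    have sq3: "3 dvd z\<^sup>2 - 1" if "3 dvd z - 1" for z :: int
    proof -
      have "z\<^sup>2 - 1 = (z + 1) * (z - 1)" by (simp add: algebra_simps power2_eq_square)
      then show ?thesis using that by simp
    qed
    have "3 dvd Z\<^sup>2" using sq3[OF X1] pXZ p by presburger
    then have "3 dvd Z" using prime_dvd_power[of "3::int"] by simp
    then obtain Y where "Z = 3 * Y" by (rule dvdE)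
    then have "int p = X\<^sup>2 + 9 * Y\<^sup>2" using pXZ by (simp add: power2_eq_square)
    then have "x\<^sup>2 = X\<^sup>2" by (rule prime_sum_square_9_unique[OF prime_p xy])
    then have "x = X \<or> x = - X" by (simp add: power2_eq_iff)
    then have "x = X" using x X1 by presburger
    then show ?thesis by (simp add: JX)
  qed
  ultimately show ?thesis by (simp only: chid)
qed

lemma chi_3_eq_1:
  assumes "p mod 12 = 1 \<or> p mod 12 = 11"
  shows "chi 3 = 1"
proof -
  have p3: "p \<noteq> 3" using assms by auto
  have rec: "Legendre (int p) 3 * chi 3 = (- 1) ^ ((p - 1) div 2 * 1)"
    using Quadratic_Reciprocity[OF prime_p p_gt_2, of 3] p3 by simp
  have L1: "Legendre 1 3 = 1"
    unfolding Legendre_def QuadRes_def by (auto simp: cong_def intro!: exI[of _ "1::int"])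
  have L2: "Legendre 2 3 = - 1"
  proof -
    have "\<not> QuadRes 3 2"
    proof
      assume "QuadRes 3 2"
      then obtain y :: int where y: "y\<^sup>2 mod 3 = 2" by (auto simp: QuadRes_def cong_def)
      have "y mod 3 = 0 \<or> y mod 3 = 1 \<or> y mod 3 = 2" by presburger
      then have "(y mod 3)\<^sup>2 mod 3 \<noteq> 2" by auto
      then show False using y by (simp add: power_mod)
    qed
    then show ?thesis by (simp add: Legendre_def cong_def)
  qed
  have LC: "Legendre a 3 = Legendre b 3" if "a mod 3 = b mod 3" for a b :: int
    using that by (simp add: Legendre_def QuadRes_def cong_def)
  from assms show ?thesis
  proof
    assume p: "p mod 12 = 1"
    have "p mod 3 = 1" using p by presburger
    then have "int p mod 3 = 1 mod 3" by (metis of_nat_1 of_nat_mod of_nat_numeral mod_mod_trivial)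
    then have "Legendre (int p) 3 = 1" using LC L1 by metis
    moreover have "even ((p - 1) div 2)" using p by presburger
    ultimately show ?thesis using rec by simp
  next
    assume p: "p mod 12 = 11"
    have "p mod 3 = 2" using p by presburger
    then have "int p mod 3 = 2 mod 3" by (metis of_nat_mod of_nat_numeral mod_mod_trivial)
    then have "Legendre (int p) 3 = - 1" using LC L2 by metis
    moreover have "odd ((p - 1) div 2)" using p by presburger
    ultimately show ?thesis using rec by simp
  qed
qed

text \<open>A square root of 3 modulo \<open>p\<close> exists by quadratic reciprocity and lifts to \<open>p\<^sup>2\<close> by one Newton step.\<close>

lemma sqrt_3_mod_square:
  assumes "p mod 12 = 1 \<or> p mod 12 = 11"
  obtains s where "[s\<^sup>2 = 3] (mod int (p\<^sup>2))"
proof -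
  have p3: "p \<noteq> 3" using assms by auto
  obtain t where t: "[t\<^sup>2 = 3] (mod int p)"
    using chi_3_eq_1[OF assms] by (auto simp: Legendre_def QuadRes_def split: if_splits)
  have nt: "\<not> int p dvd t"
  proof
    assume "int p dvd t"
    then have "int p dvd t\<^sup>2" by (simp add: power2_eq_square)
    then have "int p dvd 3" using t by (metis cong_dvd_iff)
    then show False using not_dvd_smooth[OF p3, of 0 1] by simp
  qed
  then have n2t: "\<not> int p dvd 2 * t" using not_dvd_2 prime_int by (simp add: prime_dvd_mult_iff)
  obtain c where c: "t\<^sup>2 - 3 = int p * c" using t by (auto simp: cong_iff_dvd_diff)
  obtain z where z: "[2 * t * z = - c] (mod int p)" using solve_linear_mod[OF n2t] by metis
  then obtain e where e: "2 * t * z + c = int p * e" by (auto simp: cong_iff_dvd_diff)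
  have "(t + int p * z)\<^sup>2 - 3 = (t\<^sup>2 - 3) + int p * (2 * t * z) + (int p)\<^sup>2 * z\<^sup>2"
    by (simp add: algebra_simps power2_eq_square)
  also have "\<dots> = int p * (2 * t * z + c) + (int p)\<^sup>2 * z\<^sup>2" unfolding c by (simp add: algebra_simps)
  also have "\<dots> = int (p\<^sup>2) * (e + z\<^sup>2)" unfolding e by (simp add: algebra_simps power2_eq_square)
  finally have "[(t + int p * z)\<^sup>2 = 3] (mod int (p\<^sup>2))" by (simp only: cong_iff_dvd_diff dvd_triv_left)
  then show ?thesis by (rule that)
qed

end

section \<open>Congruences between p-integral rational numbers\<close>

lemma p_integral_iff:
  assumes "prime p"
  shows "r \<in> p_integral p \<longleftrightarrow> (\<exists>a b. r = of_int a / of_int b \<and> coprime b (int p))"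
proof
  assume "r \<in> p_integral p"
  then show "\<exists>a b. r = of_int a / of_int b \<and> coprime b (int p)"
    using quotient_of_div[of r "fst (quotient_of r)" "snd (quotient_of r)"]
    by (auto simp: p_integral_def)
next
  assume "\<exists>a b. r = of_int a / of_int b \<and> coprime b (int p)"
  then obtain a b where ab: "r = of_int a / of_int b" "coprime b (int p)" by auto
  obtain c d where q: "quotient_of r = (c, d)" by (cases "quotient_of r")
  have d: "d > 0" "coprime c d" "r = of_int c / of_int d"
    using quotient_of_denom_pos[OF q] quotient_of_coprime[OF q] quotient_of_div[OF q] by auto
  have "b \<noteq> 0" using ab(2) assms by auto
  then have "(of_int (a * d) :: rat) = of_int (c * b)" using ab(1) d by (simp add: field_simps)
  then have "a * d = c * b" by (simp only: of_int_eq_iff)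
  then have "d dvd c * b" by (metis dvd_triv_right)
  then have "d dvd b" using d(2) by (simp add: coprime_dvd_mult_right_iff coprime_commute)
  then have "coprime d (int p)" using ab(2) by (meson coprime_divisors dvd_refl)
  then show "r \<in> p_integral p" by (simp add: p_integral_def q)
qed

lemma p_integral_of_int [simp]: "of_int a \<in> p_integral p"
  by (simp add: p_integral_def)

lemma p_integral_divide:
  "prime p \<Longrightarrow> coprime b (int p) \<Longrightarrow> of_int a / of_int b \<in> p_integral p"
  by (auto simp: p_integral_iff)

lemma p_integral_add:
  assumes "prime p" "x \<in> p_integral p" "y \<in> p_integral p"
  shows "x + y \<in> p_integral p"
proof -
  obtain a b c d where x: "x = of_int a / of_int b" "coprime b (int p)"
    and y: "y = of_int c / of_int d" "coprime d (int p)"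
    using assms by (auto simp: p_integral_iff)
  have "b \<noteq> 0" "d \<noteq> 0" using x(2) y(2) assms(1) by auto
  then have eq: "x + y = of_int (a * d + c * b) / of_int (b * d)"
    by (simp add: x y add_frac_eq)
  have "coprime (b * d) (int p)" using x(2) y(2) by simp
  then show ?thesis unfolding eq by (rule p_integral_divide[OF assms(1)])
qed

lemma p_integral_mult:
  assumes "prime p" "x \<in> p_integral p" "y \<in> p_integral p"
  shows "x * y \<in> p_integral p"
proof -
  obtain a b c d where x: "x = of_int a / of_int b" "coprime b (int p)"
    and y: "y = of_int c / of_int d" "coprime d (int p)"
    using assms by (auto simp: p_integral_iff)
  then show ?thesis
    using p_integral_divide[OF assms(1), of "b * d" "a * c"] by simp
qed

lemma rat_cong_refl: "x \<in> p_integral p \<Longrightarrow> rat_cong p m x x"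
  unfolding rat_cong_def using p_integral_of_int[of 0] by (auto intro!: bexI[of _ 0])

lemma rat_cong_trans:
  assumes "prime p" "rat_cong p m x y" "rat_cong p m y z"
  shows "rat_cong p m x z"
proof -
  obtain t u where "x - y = of_nat m * t" "y - z = of_nat m * u" "t \<in> p_integral p" "u \<in> p_integral p"
    using assms by (auto simp: rat_cong_def)
  then have "x - z = of_nat m * (t + u)" "t + u \<in> p_integral p"
    using p_integral_add[OF assms(1)] by (auto simp: algebra_simps)
  then show ?thesis using assms by (auto simp: rat_cong_def)
qed

lemma rat_cong_add:
  assumes "prime p" "rat_cong p m x y" "rat_cong p m x' y'"
  shows "rat_cong p m (x + x') (y + y')"
proof -
  obtain t u where "x - y = of_nat m * t" "x' - y' = of_nat m * u" "t \<in> p_integral p" "u \<in> p_integral p"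
    using assms by (auto simp: rat_cong_def)
  then have "(x + x') - (y + y') = of_nat m * (t + u)" "t + u \<in> p_integral p"
    using p_integral_add[OF assms(1)] by (auto simp: algebra_simps)
  then show ?thesis
    using assms p_integral_add[OF assms(1)] unfolding rat_cong_def by blast
qed

lemma rat_cong_mult:
  assumes "prime p" "rat_cong p m x y" "rat_cong p m x' y'"
  shows "rat_cong p m (x * x') (y * y')"
proof -
  obtain t u where tu: "x - y = of_nat m * t" "x' - y' = of_nat m * u" "t \<in> p_integral p" "u \<in> p_integral p"
    using assms by (auto simp: rat_cong_def)
  have "x * x' - y * y' = (x - y) * x' + y * (x' - y')" by (simp add: algebra_simps)
  also have "\<dots> = of_nat m * (t * x' + y * u)" unfolding tu by (simp add: algebra_simps)
  finally have "x * x' - y * y' = of_nat m * (t * x' + y * u)" .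
  moreover have "t * x' + y * u \<in> p_integral p"
    using assms tu p_integral_add[OF assms(1)] p_integral_mult[OF assms(1)] by (simp add: rat_cong_def)
  ultimately show ?thesis
    using assms p_integral_mult[OF assms(1)] unfolding rat_cong_def by blast
qed

lemma rat_cong_power:
  assumes "prime p" "rat_cong p m x y"
  shows "rat_cong p m (x ^ k) (y ^ k)"
  by (induction k) (use assms p_integral_of_int[of 1] in \<open>auto intro: rat_cong_refl rat_cong_mult\<close>)

lemma rat_cong_sum:
  assumes "prime p" "\<And>i. i \<in> A \<Longrightarrow> rat_cong p m (f i) (g i)"
  shows "rat_cong p m (\<Sum>i\<in>A. f i) (\<Sum>i\<in>A. g i)"
  using assms(2)
proof (induction A rule: infinite_finite_induct)
  case (insert x F)
  then show ?case using rat_cong_add[OF assms(1)] by simp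
qed (use rat_cong_refl p_integral_of_int[of 0] in auto)

lemma rat_cong_of_int:
  assumes "[a = b] (mod int m)"
  shows "rat_cong p m (of_int a) (of_int b)"
proof -
  obtain c where "a - b = int m * c" using assms by (auto simp: cong_iff_dvd_diff)
  then have "(of_int a - of_int b :: rat) = of_nat m * of_int c"
    by (metis of_int_diff of_int_mult of_int_of_nat_eq)
  then show ?thesis unfolding rat_cong_def using p_integral_of_int by blast
qed

lemma rat_cong_fraction:
  assumes p: "prime p" and b: "coprime b (int p)" and z: "[b * z = a] (mod int m)"
  shows "rat_cong p m (of_int a / of_int b) (of_int z)"
proof -
  have b0: "b \<noteq> 0" using b p by auto
  obtain c where c: "a - b * z = int m * c" using cong_sym[OF z] by (auto simp: cong_iff_dvd_diff)
  have "(of_int a / of_int b - of_int z :: rat) = of_int (a - b * z) / of_int b"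
    using b0 by (simp add: field_simps)
  also have "\<dots> = of_nat m * (of_int c / of_int b)" unfolding c by simp
  finally have "(of_int a / of_int b - of_int z :: rat) = of_nat m * (of_int c / of_int b)" .
  then show ?thesis unfolding rat_cong_def
    using p_integral_divide[OF p b] p_integral_of_int by blast
qed

context odd_prime
begin

lemma legendre_poly_rat_cong:
  assumes p3: "p \<noteq> 3" and v: "[1536 * v = 12 - 7 * s] (mod int p)"
  shows "rat_cong p p (poly (legendre_poly (p div 4)) (7 / 12 * of_int s))
           (of_int (\<Sum>k<p. int (quartic_coeff k) * v ^ k))"
proof -
  let ?n = "p div 4"
  have n24: "\<not> int p dvd 24" using not_dvd_smooth[OF p3, of 3 1] by simp
  have u: "[24 * (- 64 * v) = 7 * s - 12] (mod int p)"
    using v by (simp add: cong_iff_dvd_diff algebra_simps) (metis dvd_minus_iff minus_diff_eq add.commute diff_diff_eq2)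
  have "coprime 24 (int p)"
    using prime_imp_coprime[OF prime_int n24] by (simp add: coprime_commute)
  from rat_cong_fraction[OF prime_p this u]
  have u': "rat_cong p p ((7 / 12 * of_int s - 1) / 2) (of_int (- 64 * v))"
    by (simp add: field_simps)
  have "poly (legendre_poly ?n) (7 / 12 * of_int s) =
      (\<Sum>k\<le>?n. of_int (int ((?n choose k) * ((?n + k) choose k))) * ((7 / 12 * of_int s - 1) / 2 :: rat) ^ k)"
    by (simp add: legendre_poly_shifted)
  also have "rat_cong p p \<dots>
      (\<Sum>k\<le>?n. of_int (int ((?n choose k) * ((?n + k) choose k))) * of_int (- 64 * v) ^ k)"
    by (intro rat_cong_sum[OF prime_p] rat_cong_mult[OF prime_p] rat_cong_power[OF prime_p] u'
        rat_cong_refl p_integral_of_int)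
  finally have 1: "rat_cong p p (poly (legendre_poly ?n) (7 / 12 * of_int s))
      (of_int (\<Sum>k\<le>?n. int ((?n choose k) * ((?n + k) choose k)) * (- 64 * v) ^ k))"
    by simp
  show ?thesis
    by (rule rat_cong_trans[OF prime_p 1]) (intro rat_cong_of_int legendre_poly_quartic_cong cong_refl)
qed

lemma quartic_parameter_exists:
  assumes "p \<noteq> 3"
  obtains v where "[1536 * v = 12 - 7 * s] (mod int (p\<^sup>2))"
proof -
  have "\<not> int p dvd 1536" using not_dvd_smooth[OF assms, of 9 1] by simp
  then have "coprime 1536 (int p)"
    using prime_imp_coprime[OF prime_int] by (metis coprime_commute)
  then have "coprime 1536 (int (p\<^sup>2))" by simp
  then obtain b where "[1536 * b = 1] (mod int (p\<^sup>2))" using cong_solve_coprime_int by blast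
  then have "[1536 * b * (12 - 7 * s) = 1 * (12 - 7 * s)] (mod int (p\<^sup>2))" by (rule cong_scalar_right)
  then show ?thesis using that[of "b * (12 - 7 * s)"] by (simp only: mult.assoc mult_1)
qed

text \<open>The parameter \<open>v\<close> is \<open>(1 - t) / 128\<close> with \<open>t = 7 s / 12\<close>, so that \<open>v (1 - 64 v) = (1 - t\<^sup>2) / 256\<close> is \<open>- 1 / 12288\<close>.\<close>

lemma central_sum_rat_cong:
  assumes p3: "p \<noteq> 3" and s: "[s\<^sup>2 = 3] (mod int (p\<^sup>2))"
    and v: "[1536 * v = 12 - 7 * s] (mod int (p\<^sup>2))"
  shows "rat_cong p (p\<^sup>2)
          (\<Sum>k = 0..p - 1. of_nat (((2 * k) choose k)\<^sup>2 * ((4 * k) choose (2 * k))) / (- 12288) ^ k)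
          (of_int ((\<Sum>k<p. int (quartic_coeff k) * v ^ k)\<^sup>2))"
proof -
  let ?w = "v * (1 - 64 * v)"
  have cop: "coprime (2 ^ a * 3 ^ b) (int p)" for a b
    using prime_imp_coprime[OF prime_int not_dvd_smooth[OF p3]] by (simp only: coprime_commute)
  have w: "[- 12288 * ?w = 1] (mod int (p\<^sup>2))"
  proof -
    define H where "H = 1536 * v - (12 - 7 * s)"
    define A where "A = s\<^sup>2 - 3"
    have HA: "int (p\<^sup>2) dvd H" "int (p\<^sup>2) dvd A" using s v by (simp_all add: H_def A_def cong_iff_dvd_diff)
    have "2 ^ 0 * 3 ^ 1 * (- 12288 * ?w - 1) = (1536 * v - (12 + 7 * s)) * H + 49 * A"
      by (simp add: H_def A_def algebra_simps power2_eq_square)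
    also have "int (p\<^sup>2) dvd \<dots>" using HA by (intro dvd_add dvd_mult)
    finally have "int (p\<^sup>2) dvd 2 ^ 0 * 3 ^ 1 * (- 12288 * ?w - 1)" .
    moreover have "coprime (int (p\<^sup>2)) (2 ^ 0 * 3 ^ 1)" using cop[of 0 1] by (simp add: coprime_commute)
    ultimately show ?thesis unfolding cong_iff_dvd_diff by (simp only: coprime_dvd_mult_right_iff)
  qed
  have "coprime (- 12288) (int p)" using cop[of 12 1] by simp
  from rat_cong_fraction[OF prime_p this w]
  have w': "rat_cong p (p\<^sup>2) (1 / (- 12288)) (of_int ?w)" by simp
  have g: "((2 * k) choose k)\<^sup>2 * ((4 * k) choose (2 * k)) = ((2 * k) choose k) * quartic_coeff k" for k
    by (simp add: quartic_coeff_def power2_eq_square)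
  have d: "a / b ^ k = a * (1 / b) ^ k" for a b :: rat and k by (simp add: power_one_over)
  have "{0..p - 1} = {..<p}" using p_gt_2 by auto
  then have "(\<Sum>k = 0..p - 1. of_nat (((2 * k) choose k)\<^sup>2 * ((4 * k) choose (2 * k))) / (- 12288) ^ k) =
      (\<Sum>k<p. of_int (int (((2 * k) choose k) * quartic_coeff k)) * (1 / (- 12288) :: rat) ^ k)"
    unfolding g d by simp
  also have "rat_cong p (p\<^sup>2) \<dots>
      (\<Sum>k<p. of_int (int (((2 * k) choose k) * quartic_coeff k)) * of_int ?w ^ k)"
    by (intro rat_cong_sum[OF prime_p] rat_cong_mult[OF prime_p] rat_cong_power[OF prime_p] w'
        rat_cong_refl p_integral_of_int)
  finally have 1: "rat_cong p (p\<^sup>2)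
      (\<Sum>k = 0..p - 1. of_nat (((2 * k) choose k)\<^sup>2 * ((4 * k) choose (2 * k))) / (- 12288) ^ k)
      (of_int (\<Sum>k<p. int (((2 * k) choose k) * quartic_coeff k) * ?w ^ k))"
    by simp
  show ?thesis
    by (rule rat_cong_trans[OF prime_p 1])
      (rule rat_cong_of_int, rule cong_sym, rule clausen_truncated[OF prime_p p_gt_2])
qed

end

lemma rat_cong_mod_square:
  assumes "prime p" "rat_cong p (p\<^sup>2) x y"
  shows "rat_cong p p x y"
proof -
  obtain t where t: "t \<in> p_integral p" "x - y = of_nat (p\<^sup>2) * t" using assms by (auto simp: rat_cong_def)
  have "of_nat p * t \<in> p_integral p"
    using p_integral_mult[OF assms(1) p_integral_of_int[of "int p"] t(1)] by simp
  moreover have "x - y = of_nat p * (of_nat p * t)" using t by (simp add: power2_eq_square)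
  ultimately show ?thesis using assms(2) unfolding rat_cong_def by blast
qed

lemma cong_mod_square: "[a = b] (mod int (p\<^sup>2)) \<Longrightarrow> [a = b] (mod int p)"
  by (rule cong_dvd_modulus) (auto simp: power2_eq_square)

theorem theorem3p2:
  fixes p :: nat
  assumes "prime p"
    and "[int p = 1] (mod 12) \<or> [int p = - 1] (mod 12)"
  shows
    "(\<forall>s::int. [s\<^sup>2 = 3] (mod int p) \<longrightarrow>
        (\<forall>x y :: int. [p = 1] (mod 12) \<and> int p = x\<^sup>2 + 9 * y\<^sup>2 \<and> 3 dvd x - 1 \<longrightarrow>
           rat_cong p p (poly (legendre_poly (p div 4)) (7 / 12 * of_int s))
             (of_int (Legendre (2 + 2 * s) (int p) * (2 * x)))) \<and>
        ([p = 11] (mod 12) \<longrightarrow>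
           rat_cong p p (poly (legendre_poly (p div 4)) (7 / 12 * of_int s)) 0)) \<and>
     (\<forall>x y :: int. [p = 1] (mod 12) \<and> int p = x\<^sup>2 + 9 * y\<^sup>2 \<longrightarrow>
        rat_cong p p
          (\<Sum>k = 0..p - 1. of_nat (((2 * k) choose k)\<^sup>2 * ((4 * k) choose (2 * k))) / (- 12288) ^ k)
          (of_int (4 * x\<^sup>2))) \<and>
     ([p = 11] (mod 12) \<longrightarrow>
        rat_cong p (p\<^sup>2)
          (\<Sum>k = 0..p - 1. of_nat (((2 * k) choose k)\<^sup>2 * ((4 * k) choose (2 * k))) / (- 12288) ^ k)
          0)"
proof -
  have p12: "p mod 12 = 1 \<or> p mod 12 = 11"
  proof -
    have "int (p mod 12) = 1 \<or> int (p mod 12) = 11"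
      using assms(2) by (auto simp: cong_def zmod_int)
    then show ?thesis by linarith
  qed
  have "p \<noteq> 2" using p12 by auto
  then have p2: "p > 2" using prime_ge_2_nat[OF assms(1)] by linarith
  interpret odd_prime p by unfold_locales (use assms(1) p2 in auto)
  have p3: "p \<noteq> 3" using p12 by auto
  let ?P = "poly (legendre_poly (p div 4)) :: rat \<Rightarrow> rat"
  let ?C = "\<lambda>v. \<Sum>k<p. int (quartic_coeff k) * v ^ k"
  let ?S = "\<Sum>k = 0..p - 1. of_nat (((2 * k) choose k)\<^sup>2 * ((4 * k) choose (2 * k))) / (- 12288) ^ k :: rat"
  have P1: "rat_cong p p (?P (7 / 12 * of_int s)) (of_int (Legendre (2 + 2 * s) (int p) * (2 * x)))"
    if s: "[s\<^sup>2 = 3] (mod int p)" and "p mod 12 = 1" "int p = x\<^sup>2 + 9 * y\<^sup>2" "3 dvd x - 1" for s x y :: int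
  proof -
    obtain v where "[1536 * v = 12 - 7 * s] (mod int (p\<^sup>2))" using quartic_parameter_exists[OF p3] .
    then have v: "[1536 * v = 12 - 7 * s] (mod int p)" by (rule cong_mod_square)
    show ?thesis
      using legendre_poly_rat_cong[OF p3 v] rat_cong_of_int[OF quartic_sum_ordinary[OF that(2) s v that(3,4)]]
      by (rule rat_cong_trans[OF prime_p])
  qed
  have P11: "rat_cong p p (?P (7 / 12 * of_int s)) 0"
    if s: "[s\<^sup>2 = 3] (mod int p)" and "p mod 12 = 11" for s :: int
  proof -
    obtain v where "[1536 * v = 12 - 7 * s] (mod int (p\<^sup>2))" using quartic_parameter_exists[OF p3] .
    then have v: "[1536 * v = 12 - 7 * s] (mod int p)" by (rule cong_mod_square)
    show ?thesis
      using rat_cong_trans[OF prime_p legendre_poly_rat_cong[OF p3 v]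
          rat_cong_of_int[OF quartic_sum_supersingular[OF that(2) s v]]]
      by simp
  qed
  obtain s where s2: "[s\<^sup>2 = 3] (mod int (p\<^sup>2))" using sqrt_3_mod_square[OF p12] .
  then have s: "[s\<^sup>2 = 3] (mod int p)" by (rule cong_mod_square)
  obtain v where v2: "[1536 * v = 12 - 7 * s] (mod int (p\<^sup>2))" using quartic_parameter_exists[OF p3] .
  then have v: "[1536 * v = 12 - 7 * s] (mod int p)" by (rule cong_mod_square)
  have S: "rat_cong p (p\<^sup>2) ?S (of_int ((?C v)\<^sup>2))" by (rule central_sum_rat_cong[OF p3 s2 v2])
  have S1: "rat_cong p p ?S (of_int (4 * x\<^sup>2))"
    if p1: "p mod 12 = 1" and xy: "int p = x\<^sup>2 + 9 * y\<^sup>2" for x y :: int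
  proof -
    have "\<not> 3 dvd x"
    proof
      assume "3 dvd x"
      then have "3 dvd int p" unfolding xy by (simp add: power2_eq_square)
      with p1 show False by presburger
    qed
    then have "3 dvd x - 1 \<or> 3 dvd - x - 1" by presburger
    then obtain z where z: "z\<^sup>2 = x\<^sup>2" "3 dvd z - 1" by (metis power2_minus)
    have "[?C v = chi (2 + 2 * s) * (2 * z)] (mod int p)"
      using xy z by (intro quartic_sum_ordinary[OF p1 s v, of z y]) auto
    then have "[(?C v)\<^sup>2 = (chi (2 + 2 * s) * (2 * z))\<^sup>2] (mod int p)" by (rule cong_pow)
    also have "(chi (2 + 2 * s) * (2 * z))\<^sup>2 = chi ((2 + 2 * s)\<^sup>2) * (4 * z\<^sup>2)"
      by (simp add: chi_mult power2_eq_square)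
    also have "chi ((2 + 2 * s)\<^sup>2) = 1"
    proof (rule chi_square, rule notI)
      assume "int p dvd 2 + 2 * s"
      from dvd_diff[OF dvd_mult[OF this, of "s - 1"] dvd_mult[OF s[unfolded cong_iff_dvd_diff], of 2]]
      have "int p dvd 4" by (simp add: algebra_simps power2_eq_square)
      then show False using not_dvd_smooth[OF p3, of 2 0] by simp
    qed
    finally have "[(?C v)\<^sup>2 = 4 * x\<^sup>2] (mod int p)" by (simp add: z)
    then show ?thesis
      using rat_cong_trans[OF prime_p rat_cong_mod_square[OF prime_p S] rat_cong_of_int] by blast
  qed
  have S11: "rat_cong p (p\<^sup>2) ?S 0" if p11: "p mod 12 = 11"
  proof -
    have "int p dvd ?C v" using quartic_sum_supersingular[OF p11 s v] by (simp add: cong_0_iff)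
    then have "int p * int p dvd ?C v * ?C v" by (rule mult_dvd_mono) (rule \<open>int p dvd ?C v\<close>)
    then have "[(?C v)\<^sup>2 = 0] (mod int (p\<^sup>2))" by (simp add: cong_0_iff power2_eq_square)
    from rat_cong_trans[OF prime_p S rat_cong_of_int[OF this]] show ?thesis by simp
  qed
  have p1: "[p = 1] (mod 12) \<longleftrightarrow> p mod 12 = 1" and p11: "[p = 11] (mod 12) \<longleftrightarrow> p mod 12 = 11"
    by (simp_all add: cong_def)
  show ?thesis unfolding p1 p11 using P1 P11 S1 S11 by blast
qed

end
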